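(* There exists a quasi-isometric embedding of $\mathbb{H}^2\times\mathbb{H}^2$ into $Sp(4,\mathbb{R})/U(2)$ that is not at bounded distance from any $AN$-map.
   Context: $\mathbb{H}^2$ is the hyperbolic plane and $Sp(4,\mathbb{R})$ is the symplectic group of $\mathbb{R}^4$ with maximal compact subgroup $U(2)$; symmetric spaces carry their invariant Riemannian metrics. A map $f:X\to Y$ of metric spaces is a $(K,C)$-quasi-isometric embedding ($K\ge 1$, $C\ge 0$) if $\frac1K d_X(x_1,x_2)-C\le d_Y(f(x_1),f(x_2))\le K d_X(x_1,x_2)+C$ for all $x_1,x_2\in X$; it is a quasi-isometric embedding if this holds for some $K,C$. Two maps $f,g:X\to Y$ are at bounded distance if $\sup_{x\in X} d_Y(f(x),g(x))<\infty$. For semisimple Lie groups $G_1,G_2$ of equal real rank with symmetric spaces $X_1,X_2$, an $AN$-map $X_1\to X_2$ is a map obtained as follows: choose Iwasawa decompositions $G_i=K_iA_iN_i$, identify $X_i$ with the solvable group $A_iN_i$ (which acts simply transitively by isometries on $X_i$), and take the map $X_1\to X_2$ given by an injective Lie group homomorphism $A_1N_1\to A_2N_2$. Here $G_1=SL(2,\mathbb{R})\times SL(2,\mathbb{R})$ and $G_2=Sp(4,\mathbb{R})$. *)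

theory Defs
  imports "HOL-Analysis.Analysis"
begin

section \<open>Maps between metric spaces\<close>

definition quasi_isometric_embedding ::
  "'a set \<Rightarrow> ('a \<Rightarrow> 'a \<Rightarrow> real) \<Rightarrow> 'b set \<Rightarrow> ('b \<Rightarrow> 'b \<Rightarrow> real) \<Rightarrow> ('a \<Rightarrow> 'b) \<Rightarrow> bool" where
  "quasi_isometric_embedding X dX Y dY f \<longleftrightarrow>
     f ` X \<subseteq> Y \<and>
     (\<exists>K C. K \<ge> 1 \<and> C \<ge> 0 \<and>
        (\<forall>x1\<in>X. \<forall>x2\<in>X.
           (1 / K) * dX x1 x2 - C \<le> dY (f x1) (f x2) \<and>
           dY (f x1) (f x2) \<le> K * dX x1 x2 + C))"

definition at_bounded_distance ::
  "'a set \<Rightarrow> ('b \<Rightarrow> 'b \<Rightarrow> real) \<Rightarrow> ('a \<Rightarrow> 'b) \<Rightarrow> ('a \<Rightarrow> 'b) \<Rightarrow> bool" where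
  "at_bounded_distance X dY f g \<longleftrightarrow> bdd_above ((\<lambda>x. dY (f x) (g x)) ` X)"

section \<open>Riemannian distance\<close>

text \<open>
  Infimum of the lengths of piecewise smooth curves in \<open>M\<close> leading from the set \<open>S\<close> to the
  set \<open>T\<close>, where \<open>F x v\<close> is the length of the tangent vector \<open>v\<close> at \<open>x\<close>.  The library's
  \<open>valid_path\<close> allows the derivative to be unbounded near a break point.  The length is
  therefore required to exist as an integral: the total function \<open>integral\<close> would give
  a curve of infinite length the value \<open>0\<close>.
\<close>

definition riemannian_dist ::
  "'a::real_normed_vector set \<Rightarrow> ('a \<Rightarrow> 'a \<Rightarrow> real) \<Rightarrow> 'a set \<Rightarrow> 'a set \<Rightarrow> real" where
  "riemannian_dist M F S T =
     Inf {L. \<exists>c. valid_path c \<and> path_image c \<subseteq> M \<and> pathstart c \<in> S \<and> pathfinish c \<in> T \<and>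
                 ((\<lambda>t. F (c t) (vector_derivative c (at t))) has_integral L) {0..1}}"

section \<open>Matrix Lie groups and Iwasawa decompositions\<close>

definition mexp :: "real^'n^'n \<Rightarrow> real^'n^'n" where
  "mexp X = (\<Sum>k. (1 / fact k) *\<^sub>R (((**) X) ^^ k) (mat 1))"

definition lie_algebra :: "(real^'n^'n) set \<Rightarrow> (real^'n^'n) set" where
  "lie_algebra G = {X. \<forall>t::real. mexp (t *\<^sub>R X) \<in> G}"

definition bracket :: "real^'n^'n \<Rightarrow> real^'n^'n \<Rightarrow> real^'n^'n" where
  "bracket X Y = X ** Y - Y ** X"

text \<open>The connected Lie subgroup with Lie algebra \<open>h\<close>, generated by the exponentials.\<close>

inductive_set analytic_subgroup :: "(real^'n^'n) set \<Rightarrow> (real^'n^'n) set"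
  for h :: "(real^'n^'n) set" where
  one: "mat 1 \<in> analytic_subgroup h"
| mult_exp: "g \<in> analytic_subgroup h \<Longrightarrow> X \<in> h \<Longrightarrow> g ** mexp X \<in> analytic_subgroup h"

text \<open>
  Trace of an endomorphism of the subspace \<open>V\<close>, computed in an orthonormal basis of \<open>V\<close>
  (on which it does not depend).
\<close>

definition trace_on :: "'a::euclidean_space set \<Rightarrow> ('a \<Rightarrow> 'a) \<Rightarrow> real" where
  "trace_on V f =
     (let B = (SOME B. B \<subseteq> V \<and> span B = V \<and> pairwise orthogonal B \<and> (\<forall>b\<in>B. norm b = 1))
      in \<Sum>b\<in>B. f b \<bullet> b)"

definition killing_form :: "(real^'n^'n) set \<Rightarrow> real^'n^'n \<Rightarrow> real^'n^'n \<Rightarrow> real" where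
  "killing_form \<gg> X Y = trace_on \<gg> (\<lambda>Z. bracket X (bracket Y Z))"

text \<open>
  A Cartan involution is an involutive automorphism of \<open>\<gg>\<close>; asking for linearity on the whole
  matrix space is no restriction, since only its values on \<open>\<gg>\<close> are used.
\<close>

definition cartan_involution :: "(real^'n^'n) set \<Rightarrow> (real^'n^'n \<Rightarrow> real^'n^'n) \<Rightarrow> bool" where
  "cartan_involution \<gg> \<theta> \<longleftrightarrow>
     linear \<theta> \<and>
     (\<forall>X\<in>\<gg>. \<theta> X \<in> \<gg> \<and> \<theta> (\<theta> X) = X) \<and>
     (\<forall>X\<in>\<gg>. \<forall>Y\<in>\<gg>. \<theta> (bracket X Y) = bracket (\<theta> X) (\<theta> Y)) \<and>
     (\<forall>X\<in>\<gg>. X \<noteq> 0 \<longrightarrow> - killing_form \<gg> X (\<theta> X) > 0)"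

definition abelian_subspace :: "(real^'n^'n) set \<Rightarrow> bool" where
  "abelian_subspace \<aa> \<longleftrightarrow> subspace \<aa> \<and> (\<forall>H\<in>\<aa>. \<forall>H'\<in>\<aa>. bracket H H' = 0)"

definition maximal_abelian_in :: "(real^'n^'n) set \<Rightarrow> (real^'n^'n) set \<Rightarrow> bool" where
  "maximal_abelian_in \<pp> \<aa> \<longleftrightarrow>
     abelian_subspace \<aa> \<and> \<aa> \<subseteq> \<pp> \<and>
     (\<forall>\<bb>. abelian_subspace \<bb> \<and> \<bb> \<subseteq> \<pp> \<and> \<aa> \<subseteq> \<bb> \<longrightarrow> \<bb> = \<aa>)"

text \<open>
  Linear functionals on \<open>\<aa>\<close> are represented by linear functionals on the whole matrix space;
  only their values on \<open>\<aa>\<close> matter.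
\<close>

definition root_space ::
  "(real^'n^'n) set \<Rightarrow> (real^'n^'n) set \<Rightarrow> (real^'n^'n \<Rightarrow> real) \<Rightarrow> (real^'n^'n) set" where
  "root_space \<gg> \<aa> \<alpha> = {X \<in> \<gg>. \<forall>H\<in>\<aa>. bracket H X = \<alpha> H *\<^sub>R X}"

definition restricted_root ::
  "(real^'n^'n) set \<Rightarrow> (real^'n^'n) set \<Rightarrow> (real^'n^'n \<Rightarrow> real) \<Rightarrow> bool" where
  "restricted_root \<gg> \<aa> \<alpha> \<longleftrightarrow>
     linear \<alpha> \<and> (\<exists>H\<in>\<aa>. \<alpha> H \<noteq> 0) \<and> root_space \<gg> \<aa> \<alpha> \<noteq> {0}"

text \<open>
  The positive system is given by the Weyl chamber of a regular element \<open>H0\<close> of \<open>\<aa>\<close>; all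
  positive systems arise in this way.  The last conjunct is the
  decomposition \<open>G = K A N\<close> itself.
\<close>

definition iwasawa_decomposition ::
  "(real^'n^'n) set \<Rightarrow> (real^'n^'n) set \<Rightarrow> (real^'n^'n) set \<Rightarrow> (real^'n^'n) set \<Rightarrow> bool" where
  "iwasawa_decomposition G K A N \<longleftrightarrow>
     (\<exists>\<theta> \<aa> H0.
        let \<gg> = lie_algebra G;
            \<kk> = {X \<in> \<gg>. \<theta> X = X};
            \<pp> = {X \<in> \<gg>. \<theta> X = - X};
            \<nn> = span (\<Union>\<alpha> \<in> {\<alpha>. restricted_root \<gg> \<aa> \<alpha> \<and> \<alpha> H0 > 0}. root_space \<gg> \<aa> \<alpha>)
        in cartan_involution \<gg> \<theta> \<and> maximal_abelian_in \<pp> \<aa> \<and>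
           H0 \<in> \<aa> \<and> (\<forall>\<alpha>. restricted_root \<gg> \<aa> \<alpha> \<longrightarrow> \<alpha> H0 \<noteq> 0) \<and>
           K = analytic_subgroup \<kk> \<and> A = analytic_subgroup \<aa> \<and> N = analytic_subgroup \<nn>) \<and>
     bij_betw (\<lambda>(k, a, n). k ** a ** n) (K \<times> A \<times> N) G"

definition set_mult :: "(real^'n^'n) set \<Rightarrow> (real^'n^'n) set \<Rightarrow> (real^'n^'n) set" where
  "set_mult A N = {a ** n | a n. a \<in> A \<and> n \<in> N}"

text \<open>A Lie group homomorphism is a continuous homomorphism (it is then automatically smooth).\<close>

definition lie_group_hom ::
  "(real^'n^'n) set \<Rightarrow> (real^'m^'m) set \<Rightarrow> (real^'n^'n \<Rightarrow> real^'m^'m) \<Rightarrow> bool" where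
  "lie_group_hom S1 S2 \<phi> \<longleftrightarrow>
     continuous_on S1 \<phi> \<and> \<phi> ` S1 \<subseteq> S2 \<and> (\<forall>s\<in>S1. \<forall>t\<in>S1. \<phi> (s ** t) = \<phi> s ** \<phi> t)"

text \<open>
  \<open>act1\<close> and \<open>act2\<close> are the actions of \<open>G1\<close> and \<open>G2\<close> on their symmetric spaces \<open>X1\<close>, \<open>X2\<close>.
  The group \<open>A N\<close> is identified with the symmetric space through its orbit map at the point
  fixed by \<open>K\<close>.
\<close>

definition AN_map ::
  "(real^'n^'n) set \<Rightarrow> 'a set \<Rightarrow> (real^'n^'n \<Rightarrow> 'a \<Rightarrow> 'a) \<Rightarrow>
   (real^'m^'m) set \<Rightarrow> 'b set \<Rightarrow> (real^'m^'m \<Rightarrow> 'b \<Rightarrow> 'b) \<Rightarrow> ('a \<Rightarrow> 'b) \<Rightarrow> bool" where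
  "AN_map G1 X1 act1 G2 X2 act2 f \<longleftrightarrow>
     (\<exists>K1 A1 N1 K2 A2 N2 o1 o2 \<phi>.
        iwasawa_decomposition G1 K1 A1 N1 \<and> iwasawa_decomposition G2 K2 A2 N2 \<and>
        o1 \<in> X1 \<and> (\<forall>k\<in>K1. act1 k o1 = o1) \<and>
        o2 \<in> X2 \<and> (\<forall>k\<in>K2. act2 k o2 = o2) \<and>
        lie_group_hom (set_mult A1 N1) (set_mult A2 N2) \<phi> \<and> inj_on \<phi> (set_mult A1 N1) \<and>
        (\<forall>s \<in> set_mult A1 N1. f (act1 s o1) = act2 (\<phi> s) o2))"

section \<open>The two symmetric spaces\<close>

text \<open>
  4x4 matrices are indexed by the sum type \<open>2 + 2\<close>, so that \<open>blocks A B C D\<close> is the matrix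
  with rows of blocks \<open>A B\<close> and \<open>C D\<close>.
\<close>

type_synonym mat4 = "real^(2 + 2)^(2 + 2)"

definition blocks :: "real^2^2 \<Rightarrow> real^2^2 \<Rightarrow> real^2^2 \<Rightarrow> real^2^2 \<Rightarrow> mat4" where
  "blocks A B C D =
     (\<chi> i j. case i of
        Inl i' \<Rightarrow> (case j of Inl j' \<Rightarrow> A $ i' $ j' | Inr j' \<Rightarrow> B $ i' $ j')
      | Inr i' \<Rightarrow> (case j of Inl j' \<Rightarrow> C $ i' $ j' | Inr j' \<Rightarrow> D $ i' $ j'))"

definition block11 :: "mat4 \<Rightarrow> real^2^2" where
  "block11 M = (\<chi> i j. M $ Inl i $ Inl j)"

definition block22 :: "mat4 \<Rightarrow> real^2^2" where
  "block22 M = (\<chi> i j. M $ Inr i $ Inr j)"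

subsection \<open>The product of two hyperbolic planes\<close>

text \<open>\<open>SL(2,R) x SL(2,R)\<close> as a group of block diagonal matrices.\<close>

definition SL2xSL2 :: "mat4 set" where
  "SL2xSL2 = {blocks A 0 0 B | A B. det A = 1 \<and> det B = 1}"

text \<open>The upper half-plane with the metric \<open>|dz| / Im z\<close>, and the product Riemannian metric.\<close>

definition H2 :: "complex set" where
  "H2 = {z. Im z > 0}"

definition H2_norm :: "complex \<Rightarrow> complex \<Rightarrow> real" where
  "H2_norm z v = cmod v / Im z"

definition H2xH2_norm :: "complex \<times> complex \<Rightarrow> complex \<times> complex \<Rightarrow> real" where
  "H2xH2_norm p v = sqrt ((H2_norm (fst p) (fst v))\<^sup>2 + (H2_norm (snd p) (snd v))\<^sup>2)"

definition H2xH2_dist :: "complex \<times> complex \<Rightarrow> complex \<times> complex \<Rightarrow> real" where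
  "H2xH2_dist p q = riemannian_dist (H2 \<times> H2) H2xH2_norm {p} {q}"

definition SL2_act :: "real^2^2 \<Rightarrow> complex \<Rightarrow> complex" where
  "SL2_act A z =
     moebius (of_real (A $ 1 $ 1)) (of_real (A $ 1 $ 2)) (of_real (A $ 2 $ 1)) (of_real (A $ 2 $ 2)) z"

definition SL2xSL2_act :: "mat4 \<Rightarrow> complex \<times> complex \<Rightarrow> complex \<times> complex" where
  "SL2xSL2_act M p = (SL2_act (block11 M) (fst p), SL2_act (block22 M) (snd p))"

subsection \<open>The space \<open>Sp(4,R)/U(2)\<close>\<close>

definition symplectic_J :: mat4 where
  "symplectic_J = blocks 0 (mat 1) (- mat 1) 0"

definition Sp4 :: "mat4 set" where
  "Sp4 = {g. transpose g ** symplectic_J ** g = symplectic_J}"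

text \<open>\<open>U(2)\<close>, embedded by sending \<open>A + i B\<close> to \<open>blocks A B (- B) A\<close>.\<close>

definition U2 :: "mat4 set" where
  "U2 = {g \<in> Sp4. orthogonal_matrix g}"

definition left_coset :: "mat4 \<Rightarrow> mat4 set" where
  "left_coset g = {g ** u | u. u \<in> U2}"

definition Sp4_mod_U2 :: "mat4 set set" where
  "Sp4_mod_U2 = left_coset ` Sp4"

text \<open>
  The invariant Riemannian metric, pulled back to \<open>Sp(4,R)\<close>.  The Lie algebra of \<open>Sp(4,R)\<close> is
  the sum of its skew-symmetric part, which is the Lie algebra of \<open>U(2)\<close>, and its symmetric
  part \<open>\<pp>\<close>, which is the tangent space of the quotient at the base point and carries the
  form \<open>trace (X ** Y)\<close>, a multiple of the Killing form.  A tangent vector \<open>V\<close> at \<open>g\<close> has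
  the length of the \<open>\<pp>\<close>-component of \<open>g\<^sup>-\<^sup>1 V\<close>.  The length of a curve in the quotient is that of
  any lift, so the distance of two cosets is an infimum over curves in \<open>Sp(4,R)\<close> from one to the
  other.
\<close>

definition Sp4_norm :: "mat4 \<Rightarrow> mat4 \<Rightarrow> real" where
  "Sp4_norm g V = (let X = matrix_inv g ** V in norm ((1 / 2) *\<^sub>R (X + transpose X)))"

definition Sp4_mod_U2_dist :: "mat4 set \<Rightarrow> mat4 set \<Rightarrow> real" where
  "Sp4_mod_U2_dist p q = riemannian_dist Sp4 Sp4_norm p q"

definition Sp4_act :: "mat4 \<Rightarrow> mat4 set \<Rightarrow> mat4 set" where
  "Sp4_act g p = (\<lambda>h. g ** h) ` p"

end

theory Submission
  imports Defs
begin

text \<open>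
  The map \<open>z \<mapsto> |z| z\<close> of the upper half-plane doubles distances along the geodesic from \<open>0\<close> to
  \<open>\<infinity>\<close>, but is an isometry up to an additive constant on balls near any other boundary point.  It is a
  quasi-isometry, and composing it in one factor with the totally geodesic embedding of the product
  of two hyperbolic planes gives the required map \<open>f\<close>.

  If an \<open>AN\<close>-map \<open>g\<close> is given by the homomorphism \<open>\<phi>\<close>, the distance of \<open>g (s \<cdot> o)\<close> and
  \<open>g (s a \<cdot> o)\<close> does not depend on \<open>s\<close>, as both points are translated by \<open>\<phi> s\<close>.  By transitivity of
  the group \<open>AN\<close>, \<open>s\<close> and \<open>a\<close> can be chosen so that \<open>s \<cdot> o\<close> and \<open>s a \<cdot> o\<close> are any two prescribed
  points of the geodesic, while another choice of \<open>s\<close> moves them close to the boundary point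
  \<open>1\<close>.  So \<open>f\<close> is not at bounded distance from \<open>g\<close>.  Distances in the target are measured by the
  logarithm of the Frobenius norm of \<open>g\<^sup>-\<^sup>1 h\<close>, which is a lower bound for the Riemannian distance of the
  cosets of \<open>g\<close> and \<open>h\<close> up to an additive constant.
\<close>

section \<open>The matrix exponential\<close>

lemma norm_matrix_sq: "(norm (A::real^'n^'m))\<^sup>2 = (\<Sum>i\<in>UNIV. (norm (A $ i))\<^sup>2)"
  by (simp add: norm_vec_def L2_set_def sum_nonneg)

lemma norm_matrix_vector_mult_le: "norm ((A::real^'n^'m) *v x) \<le> norm A * norm x"
proof -
  have "(norm (A *v x))\<^sup>2 = (\<Sum>i\<in>UNIV. (A $ i \<bullet> x)\<^sup>2)"
    by (simp add: norm_vec_def L2_set_def sum_nonneg matrix_vector_mul_component)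
  also have "\<dots> \<le> (\<Sum>i\<in>UNIV. (norm (A $ i))\<^sup>2 * (norm x)\<^sup>2)"
    by (intro sum_mono) (simp add: Cauchy_Schwarz_ineq power2_norm_eq_inner)
  also have "\<dots> = (norm A * norm x)\<^sup>2"
    by (simp add: power_mult_distrib norm_matrix_sq sum_distrib_right)
  finally show ?thesis
    by (rule power2_le_imp_le) simp
qed

lemma norm_transpose: "norm (transpose (A::real^'n^'m)) = norm A"
proof -
  have "(norm (transpose A))\<^sup>2 = (norm A)\<^sup>2"
    by (simp add: norm_matrix_sq norm_vec_def L2_set_def sum_nonneg transpose_def)
      (rule sum.swap)
  then show ?thesis by simp
qed

lemma row_matrix_mult: "((A::real^'n^'m) ** (B::real^'k^'n)) $ i = transpose B *v (A $ i)"
  by (simp add: vec_eq_iff matrix_matrix_mult_def matrix_vector_mult_def transpose_def mult.commute)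

text \<open>The rows of the product are \<open>transpose B\<close> applied to the rows of
  \<open>A\<close>, so Cauchy-Schwarz applies row by row. Submultiplicativity later acts as a
  triangle inequality for the logarithm of the norm.\<close>

lemma norm_matrix_mult_le: "norm ((A::real^'n^'m) ** (B::real^'k^'n)) \<le> norm A * norm B"
proof -
  have "(norm (A ** B))\<^sup>2 = (\<Sum>i\<in>UNIV. (norm (transpose B *v (A $ i)))\<^sup>2)"
    by (simp add: norm_matrix_sq row_matrix_mult)
  also have "\<dots> \<le> (\<Sum>i\<in>UNIV. (norm B * norm (A $ i))\<^sup>2)"
    by (intro sum_mono power_mono norm_ge_zero)
      (metis norm_matrix_vector_mult_le norm_transpose)
  also have "\<dots> = (norm A * norm B)\<^sup>2"
    by (simp add: power_mult_distrib norm_matrix_sq[of A] sum_distrib_left mult.commute)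
  finally show ?thesis
    by (rule power2_le_imp_le) simp
qed

lemma bounded_bilinear_matrix_mult:
  "bounded_bilinear ((**) :: real^'n^'m \<Rightarrow> real^'k^'n \<Rightarrow> real^'k^'m)"
proof
  show "\<exists>K. \<forall>(a::real^'n^'m) (b::real^'k^'n). norm (a ** b) \<le> norm a * norm b * K"
    by (rule exI[of _ 1]) (simp add: norm_matrix_mult_le)
qed (simp_all add: vec_eq_iff matrix_matrix_mult_def sum.distrib algebra_simps sum_distrib_left)

lemmas bounded_linear_matrix_mult_left =
  bounded_bilinear.bounded_linear_left[OF bounded_bilinear_matrix_mult]
lemmas bounded_linear_matrix_mult_right =
  bounded_bilinear.bounded_linear_right[OF bounded_bilinear_matrix_mult]

lemma bounded_linear_matrix_entry: "bounded_linear (\<lambda>A::real^'n^'m. A $ i $ j)"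
  by (intro bounded_linear_compose[OF bounded_linear_vec_nth bounded_linear_vec_nth])

section \<open>Powers and the exponential series\<close>

definition mpow :: "real^'n^'n \<Rightarrow> nat \<Rightarrow> real^'n^'n" where
  "mpow X k = (((**) X) ^^ k) (mat 1)"

lemma mpow_0 [simp]: "mpow X 0 = mat 1"
  and mpow_Suc: "mpow X (Suc k) = X ** mpow X k"
  by (simp_all add: mpow_def)

lemma mpow_add: "mpow X (k + l) = mpow X k ** mpow X l"
  by (induction k) (simp_all add: mpow_Suc matrix_mul_assoc)

lemma mpow_scale: "mpow (c *\<^sub>R X) k = c ^ k *\<^sub>R mpow X k"
  by (induction k) (simp_all add: mpow_Suc bounded_bilinear.scaleR_left[OF bounded_bilinear_matrix_mult]
      bounded_bilinear.scaleR_right[OF bounded_bilinear_matrix_mult])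

lemma mpow_uminus: "mpow (- X) k = (-1) ^ k *\<^sub>R mpow X k"
  using mpow_scale[of "-1" X k] by simp

text \<open>In positive powers the inner factors \<open>P' ** P\<close> cancel. The assumption is
  one-sided, so the zeroth power leaves the defect \<open>mat 1 - P ** P'\<close>.\<close>

lemma mpow_conj:
  assumes "P' ** P = mat 1"
  shows "mpow (P ** X ** P') k = P ** mpow X k ** P' + (if k = 0 then mat 1 - P ** P' else 0)"
proof (induction k)
  case (Suc k)
  show ?case
  proof (cases "k = 0")
    case False
    then have "mpow (P ** X ** P') (Suc k) = P ** X ** (P' ** P) ** mpow X k ** P'"
      using Suc by (simp add: mpow_Suc matrix_mul_assoc)
    then show ?thesis using assms by (simp add: mpow_Suc matrix_mul_assoc)
  qed (simp add: mpow_Suc)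
qed simp

lemma norm_mpow_le: "norm (mpow X k) \<le> norm (mat 1 :: real^'n^'n) * norm (X::real^'n^'n) ^ k"
proof (induction k)
  case (Suc k)
  have "norm (mpow X (Suc k)) \<le> norm X * norm (mpow X k)"
    by (simp add: mpow_Suc norm_matrix_mult_le)
  also have "\<dots> \<le> norm X * (norm (mat 1 :: real^'n^'n) * norm X ^ k)"
    by (intro mult_left_mono Suc) simp
  finally show ?case by (simp add: mult_ac)
qed simp

lemma summable_norm_mexp: "summable (\<lambda>k. norm ((1 / fact k) *\<^sub>R mpow (X::real^'n^'n) k))"
proof (rule summable_comparison_test')
  show "summable (\<lambda>k. norm (mat 1 :: real^'n^'n) * (norm X ^ k /\<^sub>R fact k))"
    by (intro summable_mult summable_exp_generic)
  show "norm (norm ((1 / fact k) *\<^sub>R mpow X k)) \<le> norm (mat 1 :: real^'n^'n) * (norm X ^ k /\<^sub>R fact k)" for k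
    using norm_mpow_le[of X k] by (simp add: divide_simps mult_ac)
qed

lemma mexp_sums: "(\<lambda>k. (1 / fact k) *\<^sub>R mpow X k) sums mexp X"
  using summable_sums[OF summable_norm_cancel[OF summable_norm_mexp[of X]]]
  by (simp add: mexp_def mpow_def)

lemma sums_matrix_iff: "(f sums (l::real^'n^'m)) \<longleftrightarrow> (\<forall>i j. (\<lambda>k. f k $ i $ j) sums (l $ i $ j))"
proof
  assume "f sums l"
  then show "\<forall>i j. (\<lambda>k. f k $ i $ j) sums (l $ i $ j)"
    using bounded_linear.sums[OF bounded_linear_matrix_entry] by blast
next
  assume "\<forall>i j. (\<lambda>k. f k $ i $ j) sums (l $ i $ j)"
  then show "f sums l"
    unfolding sums_def by (intro vec_tendstoI) (simp add: sum_component)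
qed

text \<open>Entrywise this is a finite sum, over the inner index of the matrix product, of Cauchy
  products of absolutely convergent real series.\<close>

lemma matrix_Cauchy_product_sums:
  fixes a :: "nat \<Rightarrow> real^'n^'m" and b :: "nat \<Rightarrow> real^'k^'n"
  assumes "summable (\<lambda>k. norm (a k))" "summable (\<lambda>k. norm (b k))" "a sums A" "b sums B"
  shows "(\<lambda>n. \<Sum>k\<le>n. a k ** b (n - k)) sums (A ** B)"
  unfolding sums_matrix_iff
proof (intro allI)
  fix i j
  have entry: "norm (M $ p $ q) \<le> norm M" for M :: "real^'x^'y" and p q
    using Finite_Cartesian_Product.norm_nth_le[of "M $ p" q] Finite_Cartesian_Product.norm_nth_le[of M p] by linarith
  have "(\<lambda>n. \<Sum>k\<le>n. a k $ i $ p * b (n - k) $ p $ j) sums (A $ i $ p * B $ p $ j)" for p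
  proof -
    have "summable (\<lambda>k. norm (a k $ i $ p))" "summable (\<lambda>k. norm (b k $ p $ j))"
      by (rule summable_comparison_test'[OF assms(1)] summable_comparison_test'[OF assms(2)],
          use entry in auto)+
    from Cauchy_product_sums[OF this] show ?thesis
      using assms(3,4) by (simp add: sums_matrix_iff sums_iff)
  qed
  then have "(\<lambda>n. \<Sum>p\<in>UNIV. \<Sum>k\<le>n. a k $ i $ p * b (n - k) $ p $ j) sums (\<Sum>p\<in>UNIV. A $ i $ p * B $ p $ j)"
    by (intro sums_sum)
  then show "(\<lambda>n. (\<Sum>k\<le>n. a k ** b (n - k)) $ i $ j) sums ((A ** B) $ i $ j)"
    by (subst (asm) sum.swap) (simp add: matrix_matrix_mult_def sum_component)
qed

lemma mexp_0: "mexp 0 = mat 1"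
proof -
  have "(\<lambda>k. (1 / fact k) *\<^sub>R mpow (0::real^'n^'n) k) sums (\<Sum>k\<in>{0}. (1 / fact k) *\<^sub>R mpow (0::real^'n^'n) k)"
  proof (rule sums_finite)
    fix n :: nat assume "n \<notin> {0}"
    then show "(1 / fact n) *\<^sub>R mpow (0::real^'n^'n) n = 0"
      by (cases n) (simp_all add: mpow_Suc)
  qed simp
  then show ?thesis using mexp_sums[of "0::real^'n^'n"] sums_unique2 by fastforce
qed

text \<open>Powers of \<open>X\<close> commute, so by the binomial theorem the term of degree
  \<open>n\<close> in the Cauchy product is \<open>(1 + (-1)) ^ n / fact n\<close> times
  \<open>mpow X n\<close>, which vanishes for \<open>n > 0\<close>.\<close>

lemma mexp_mult_uminus: "mexp (X::real^'n^'n) ** mexp (- X) = mat 1"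
proof -
  have "(\<Sum>k\<le>n. ((1 / fact k) *\<^sub>R mpow X k) ** ((1 / fact (n - k)) *\<^sub>R mpow (- X) (n - k))) =
        (if n = 0 then mat 1 else 0)" for n
  proof -
    have "(\<Sum>k\<le>n. ((1 / fact k) *\<^sub>R mpow X k) ** ((1 / fact (n - k)) *\<^sub>R mpow (- X) (n - k))) =
          (\<Sum>k\<le>n. (of_nat (n choose k) * 1 ^ k * (-1) ^ (n - k) / fact n) *\<^sub>R mpow X n)"
    proof (intro sum.cong refl)
      fix k assume "k \<in> {..n}"
      then have k: "k \<le> n" by simp
      have "mpow X k ** mpow X (n - k) = mpow X n"
        using k by (simp flip: mpow_add)
      then show "((1 / fact k) *\<^sub>R mpow X k) ** ((1 / fact (n - k)) *\<^sub>R mpow (- X) (n - k)) =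
          (of_nat (n choose k) * 1 ^ k * (-1) ^ (n - k) / fact n) *\<^sub>R mpow X n"
        using k by (simp add: mpow_uminus bounded_bilinear.scaleR_left[OF bounded_bilinear_matrix_mult]
            bounded_bilinear.scaleR_right[OF bounded_bilinear_matrix_mult] binomial_fact)
    qed
    also have "\<dots> = ((1 + (-1)) ^ n / fact n) *\<^sub>R mpow X n"
      by (subst binomial_ring) (simp add: scaleR_left.sum sum_divide_distrib)
    finally show ?thesis by simp
  qed
  moreover have "(\<lambda>n. if n = 0 then mat 1 else 0 :: real^'n^'n) sums mat 1"
    using sums_single[of 0 "\<lambda>_. mat 1 :: real^'n^'n"] by simp
  ultimately show ?thesis
    using matrix_Cauchy_product_sums[OF summable_norm_mexp summable_norm_mexp mexp_sums mexp_sums, of X "- X"]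
    by (simp add: sums_unique2)
qed

lemma mexp_uminus_mult: "mexp (- X) ** mexp X = mat 1"
  using mexp_mult_uminus[of "- X"] by simp

lemma mexp_conj:
  assumes "P' ** P = mat 1" "P ** P' = mat 1"
  shows "mexp (P ** X ** P') = P ** mexp X ** P'"
proof -
  have "(\<lambda>k. P ** ((1 / fact k) *\<^sub>R mpow X k) ** P') sums (P ** mexp X ** P')"
    by (intro bounded_linear.sums[OF bounded_linear_matrix_mult_left]
        bounded_linear.sums[OF bounded_linear_matrix_mult_right] mexp_sums)
  moreover have "P ** ((1 / fact k) *\<^sub>R mpow X k) ** P' = (1 / fact k) *\<^sub>R mpow (P ** X ** P') k" for k
    using mpow_conj[OF assms(1), of X k] assms(2)
    by (simp add: bounded_bilinear.scaleR_left[OF bounded_bilinear_matrix_mult]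
            bounded_bilinear.scaleR_right[OF bounded_bilinear_matrix_mult])
  ultimately show ?thesis
    using mexp_sums[of "P ** X ** P'"] sums_unique2 by fastforce
qed

text \<open>Moving \<open>H\<close> past \<open>X\<close> adds the scalar \<open>c\<close>, so
  \<open>H^n X = X (H + c)^n\<close>; summing over \<open>n\<close> gives the exponential of
  \<open>H + c\<close>, in which \<open>c\<close> contributes the factor \<open>exp c\<close>. This
  is the action of \<open>A\<close> on root vectors.\<close>

lemma mexp_mult_eigenvector:
  assumes "bracket H X = c *\<^sub>R X"
  shows "mexp H ** X = exp c *\<^sub>R (X ** mexp H)"
proof -
  note bil = bounded_bilinear_matrix_mult
  have HX: "H ** X = X ** H + c *\<^sub>R X"
    using assms by (simp add: bracket_def algebra_simps)
  define a where "a j = (c ^ j / fact j) *\<^sub>R X" for j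
  define b where "b k = (1 / fact k) *\<^sub>R mpow H k" for k
  \<comment> \<open>The binomial expansion of \<open>X (H + c)^n\<close>; the induction step is
    Pascal's rule.\<close>
  have pw: "mpow H n ** X = (\<Sum>k\<le>n. (of_nat (n choose k) * c ^ k) *\<^sub>R (X ** mpow H (n - k)))" for n
  proof (induction n)
    case (Suc n)
    define u where "u k = X ** mpow H k" for k
    have Hu: "H ** u k = u (Suc k) + c *\<^sub>R u k" for k
    proof -
      have "H ** u k = (X ** H + c *\<^sub>R X) ** mpow H k"
        by (simp add: u_def matrix_mul_assoc HX)
      then show ?thesis
        by (simp add: u_def mpow_Suc matrix_mul_assoc bounded_bilinear.add_left[OF bil]
            bounded_bilinear.scaleR_left[OF bil])
    qed
    have "mpow H (Suc n) ** X = (\<Sum>k\<le>n. (of_nat (n choose k) * c ^ k) *\<^sub>R (H ** u (n - k)))"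
      using Suc by (simp add: mpow_Suc matrix_mul_assoc[symmetric] u_def bounded_bilinear.sum_right[OF bil]
            bounded_bilinear.scaleR_right[OF bil])
    also have "\<dots> = (\<Sum>k\<le>n. (of_nat (n choose k) * c ^ k) *\<^sub>R u (Suc n - k)) +
                     (\<Sum>k\<le>n. (of_nat (n choose k) * c ^ Suc k) *\<^sub>R u (n - k))"
      by (simp add: Hu scaleR_add_right sum.distrib Suc_diff_le mult_ac)
    also have "(\<Sum>k\<le>n. (of_nat (n choose k) * c ^ k) *\<^sub>R u (Suc n - k)) =
               (\<Sum>k\<le>Suc n. (of_nat (n choose k) * c ^ k) *\<^sub>R u (Suc n - k))"
      by simp
    also have "\<dots> = u (Suc n) + (\<Sum>k\<le>n. (of_nat (n choose Suc k) * c ^ Suc k) *\<^sub>R u (n - k))"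
      by (subst sum.atMost_Suc_shift) simp
    also have "\<dots> + (\<Sum>k\<le>n. (of_nat (n choose k) * c ^ Suc k) *\<^sub>R u (n - k)) =
       u (Suc n) + (\<Sum>k\<le>n. (of_nat (Suc n choose Suc k) * c ^ Suc k) *\<^sub>R u (n - k))"
      by (simp add: sum.distrib[symmetric] scaleR_add_left[symmetric] algebra_simps del: scaleR_add_left scaleR_left_distrib)
    also have "\<dots> = (\<Sum>k\<le>Suc n. (of_nat (Suc n choose k) * c ^ k) *\<^sub>R u (Suc n - k))"
      by (subst sum.atMost_Suc_shift[of _ n]) simp
    finally show ?case by (simp add: u_def)
  qed simp
  have "(\<lambda>j. (c ^ j /\<^sub>R fact j) *\<^sub>R X) sums (exp c *\<^sub>R X)"
    by (intro bounded_linear.sums[OF bounded_linear_scaleR_left] exp_converges)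
  then have a: "a sums (exp c *\<^sub>R X)"
    unfolding a_def by (simp add: divide_inverse mult.commute)
  have "summable (\<lambda>j. norm X * norm (c ^ j /\<^sub>R fact j))"
    by (intro summable_mult summable_norm_exp)
  then have na: "summable (\<lambda>j. norm (a j))"
    by (simp add: a_def divide_inverse mult_ac)
  have "(\<lambda>n. \<Sum>k\<le>n. a k ** b (n - k)) sums ((exp c *\<^sub>R X) ** mexp H)"
    using matrix_Cauchy_product_sums[OF na _ a, of b] summable_norm_mexp[of H] mexp_sums[of H]
    by (simp add: b_def[abs_def])
  moreover have "(\<Sum>k\<le>n. a k ** b (n - k)) = ((1 / fact n) *\<^sub>R mpow H n) ** X" for n
    unfolding bounded_bilinear.scaleR_left[OF bil] pw scaleR_sum_right
    by (intro sum.cong refl)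
      (simp add: a_def b_def bounded_bilinear.scaleR_left[OF bil] bounded_bilinear.scaleR_right[OF bil]
        binomial_fact field_simps)
  moreover have "(\<lambda>n. ((1 / fact n) *\<^sub>R mpow H n) ** X) sums (mexp H ** X)"
    by (intro bounded_linear.sums[OF bounded_linear_matrix_mult_left] mexp_sums)
  ultimately show ?thesis
    by (simp add: sums_unique2 bounded_bilinear.scaleR_left[OF bil])
qed

section \<open>The solvable group of an Iwasawa decomposition\<close>

lemma matrix_inv_eqI:
  fixes A B :: "real^'n^'n"
  assumes "A ** B = mat 1"
  shows "matrix_inv A = B"
proof -
  have BA: "B ** A = mat 1" using assms matrix_left_right_inverse by blast
  then have "A ** matrix_inv A = mat 1"
    unfolding matrix_inv_def using someI[of "\<lambda>A'. A ** A' = mat 1 \<and> A' ** A = mat 1" B] assms by blast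
  then show ?thesis using BA by (metis matrix_mul_assoc matrix_mul_lid matrix_mul_rid)
qed

lemma analytic_subgroup_mult:
  assumes "g \<in> analytic_subgroup h" "g' \<in> analytic_subgroup h"
  shows "g ** g' \<in> analytic_subgroup h"
  using assms(2)
proof induction
  case (mult_exp g' X)
  then show ?case by (simp add: matrix_mul_assoc analytic_subgroup.mult_exp)
qed (simp add: assms(1))

lemma mexp_in_analytic_subgroup: "X \<in> h \<Longrightarrow> mexp X \<in> analytic_subgroup h"
  using analytic_subgroup.mult_exp[OF analytic_subgroup.one, of X h] by simp

lemma analytic_subgroup_inverse:
  assumes "g \<in> analytic_subgroup h" and neg: "\<And>X. X \<in> h \<Longrightarrow> - X \<in> h"
  shows "\<exists>g'\<in>analytic_subgroup h. g ** g' = mat 1 \<and> g' ** g = mat 1"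
  using assms(1)
proof induction
  case one
  show ?case by (rule bexI[of _ "mat 1"]) (simp_all add: analytic_subgroup.one)
next
  case (mult_exp g X)
  then obtain g' where g': "g' \<in> analytic_subgroup h" "g ** g' = mat 1" by blast
  have "mexp (- X) ** g' \<in> analytic_subgroup h"
    by (intro analytic_subgroup_mult mexp_in_analytic_subgroup neg mult_exp g')
  moreover have "(g ** mexp X) ** (mexp (- X) ** g') = g ** (mexp X ** mexp (- X)) ** g'"
    by (simp add: matrix_mul_assoc)
  ultimately show ?case
    using g'(2) by (intro bexI[of _ "mexp (- X) ** g'"])
      (auto simp: mexp_mult_uminus matrix_left_right_inverse)
qed

lemma analytic_subgroup_conj:
  assumes "a ** a' = mat 1" "a' ** a = mat 1"
    and conj: "\<And>X. X \<in> h \<Longrightarrow> a ** X ** a' \<in> h"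
    and "n \<in> analytic_subgroup h"
  shows "a ** n ** a' \<in> analytic_subgroup h"
  using assms(4)
proof induction
  case (mult_exp g X)
  have "a ** (g ** mexp X) ** a' = (a ** g ** a') ** (a ** mexp X ** a')"
    using assms(2) by (metis matrix_mul_assoc matrix_mul_lid)
  then show ?case
    using mult_exp conj assms(1,2) by (simp add: analytic_subgroup.mult_exp flip: mexp_conj)
qed (simp add: assms(1) analytic_subgroup.one)

text \<open>Conjugation by \<open>mexp H\<close> multiplies an eigenvector of \<open>ad H\<close> by
  the exponential of its eigenvalue, so it maps the span of eigenvectors to itself.\<close>

lemma mexp_Ad_root_span:
  assumes "\<And>X. X \<in> R \<Longrightarrow> \<exists>c. bracket H X = c *\<^sub>R X" and "X \<in> span R"
  shows "mexp H ** X ** mexp (- H) \<in> span R"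
  using assms(2)
proof (induction rule: span_induct_alt)
  case base
  then show ?case by (simp add: span_zero)
next
  case (step c x y)
  obtain d where d: "bracket H x = d *\<^sub>R x" using assms(1) step by blast
  have "mexp H ** x ** mexp (- H) = exp d *\<^sub>R (x ** (mexp H ** mexp (- H)))"
    by (simp add: mexp_mult_eigenvector[OF d] matrix_mul_assoc
        bounded_bilinear.scaleR_left[OF bounded_bilinear_matrix_mult])
  then have "mexp H ** x ** mexp (- H) \<in> span R"
    using step by (simp add: mexp_mult_uminus span_mul span_base)
  moreover have "mexp H ** (c *\<^sub>R x + y) ** mexp (- H) =
      c *\<^sub>R (mexp H ** x ** mexp (- H)) + mexp H ** y ** mexp (- H)"
    by (simp add: bounded_bilinear.scaleR_left[OF bounded_bilinear_matrix_mult]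
        bounded_bilinear.scaleR_right[OF bounded_bilinear_matrix_mult]
        bounded_bilinear.add_left[OF bounded_bilinear_matrix_mult]
        bounded_bilinear.add_right[OF bounded_bilinear_matrix_mult])
  ultimately show ?case using step by (simp add: span_add span_mul)
qed

text \<open>In the application, \<open>A\<close> normalizes \<open>N\<close>. The induction peels
  off the last exponential factor of \<open>a\<close>; \<open>n\<close> and \<open>a'\<close> vary
  because that factor conjugates \<open>n\<close> first.\<close>

lemma analytic_subgroup_normalizes:
  assumes "\<And>H X. H \<in> h \<Longrightarrow> X \<in> R \<Longrightarrow> \<exists>c. bracket H X = c *\<^sub>R X"
    and neg: "\<And>X. X \<in> h \<Longrightarrow> - X \<in> h"
    and a: "a \<in> analytic_subgroup h" and n: "n \<in> analytic_subgroup (span R)"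
    and inv: "a ** a' = mat 1"
  shows "a ** n ** a' \<in> analytic_subgroup (span R)"
  using a n inv
proof (induction arbitrary: n a')
  case (mult_exp g H)
  obtain g' where g': "g ** g' = mat 1" "g' ** g = mat 1"
    using analytic_subgroup_inverse[OF mult_exp(1) neg] by blast
  have "(g ** mexp H) ** (mexp (- H) ** g') = mat 1"
    using g'(1) by (metis matrix_mul_assoc matrix_mul_rid mexp_mult_uminus)
  then have "a' = mexp (- H) ** g'"
    using mult_exp.prems(2) matrix_inv_eqI by metis
  moreover have "mexp H ** n ** mexp (- H) \<in> analytic_subgroup (span R)"
    by (intro analytic_subgroup_conj mexp_Ad_root_span mexp_mult_uminus mexp_uminus_mult)
      (use assms(1) mult_exp in auto)
  from mult_exp.IH[OF this g'(1)] 
  have "g ** (mexp H ** n ** mexp (- H)) ** g' \<in> analytic_subgroup (span R)" .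
  ultimately show ?case by (simp add: matrix_mul_assoc)
qed simp

text \<open>\<open>R\<close> is the union of the root spaces of the positive roots. Its elements are
  eigenvectors of every \<open>ad H\<close> with \<open>H\<close> in \<open>\<aa>\<close>, which is
  the form that \<open>analytic_subgroup_normalizes\<close> requires.\<close>

lemma iwasawa_decompositionE:
  assumes "iwasawa_decomposition G K A N"
  obtains \<kk> \<aa> R where
    "K = analytic_subgroup \<kk>" "A = analytic_subgroup \<aa>" "N = analytic_subgroup (span R)"
    "\<And>X t. X \<in> \<kk> \<Longrightarrow> mexp (t *\<^sub>R X) \<in> G" "subspace \<aa>"
    "\<And>H X. H \<in> \<aa> \<Longrightarrow> X \<in> R \<Longrightarrow> \<exists>c. bracket H X = c *\<^sub>R X"
    "bij_betw (\<lambda>(k, a, n). k ** a ** n) (K \<times> A \<times> N) G"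
proof -
  obtain \<theta> \<aa> H0 where *: "maximal_abelian_in {X \<in> lie_algebra G. \<theta> X = - X} \<aa>"
    "K = analytic_subgroup {X \<in> lie_algebra G. \<theta> X = X}" "A = analytic_subgroup \<aa>"
    "N = analytic_subgroup (span (\<Union>\<alpha> \<in> {\<alpha>. restricted_root (lie_algebra G) \<aa> \<alpha> \<and> \<alpha> H0 > 0}.
       root_space (lie_algebra G) \<aa> \<alpha>))"
    "bij_betw (\<lambda>(k, a, n). k ** a ** n) (K \<times> A \<times> N) G"
    using assms unfolding iwasawa_decomposition_def Let_def by blast
  show ?thesis
    by (rule that[OF *(2-4) _ _ _ *(5)])
      (use *(1) in \<open>auto simp: lie_algebra_def maximal_abelian_in_def abelian_subspace_def root_space_def\<close>)
qed

context
  fixes G K A N :: "(real^'n^'n) set"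
  assumes iwasawa: "iwasawa_decomposition G K A N"
begin

lemma iwasawa_one: "mat 1 \<in> K" "mat 1 \<in> A" "mat 1 \<in> N"
  using iwasawa by (auto elim!: iwasawa_decompositionE intro: analytic_subgroup.one)

lemma iwasawa_mult_in: "k \<in> K \<Longrightarrow> a \<in> A \<Longrightarrow> n \<in> N \<Longrightarrow> k ** a ** n \<in> G"
  using iwasawa by (elim iwasawa_decompositionE) (auto simp: bij_betw_def image_def)

lemma iwasawa_subset: "K \<subseteq> G" "set_mult A N \<subseteq> G"
  using iwasawa_mult_in[OF _ iwasawa_one(2,3)] iwasawa_mult_in[OF iwasawa_one(1)]
  by (auto simp: set_mult_def)

lemma iwasawa_factor:
  assumes "g \<in> G"
  obtains k s where "k \<in> K" "s \<in> set_mult A N" "g = k ** s"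
proof -
  have "g \<in> (\<lambda>(k, a, n). k ** a ** n) ` (K \<times> A \<times> N)"
    using iwasawa assms by (elim iwasawa_decompositionE) (auto simp: bij_betw_def)
  then show ?thesis
    using that by (fastforce simp: set_mult_def matrix_mul_assoc)
qed

text \<open>The inverse \<open>n' ** a'\<close> comes with its factors in the wrong order. Writing
  it as \<open>a' ** (a ** n' ** a')\<close> repairs this, because \<open>A\<close> normalizes
  \<open>N\<close>.\<close>

lemma AN_inverse:
  assumes "s \<in> set_mult A N"
  obtains s' where "s' \<in> set_mult A N" "s ** s' = mat 1" "s' ** s = mat 1"
proof -
  obtain \<kk> \<aa> R where I: "A = analytic_subgroup \<aa>" "N = analytic_subgroup (span R)" "subspace \<aa>"
    "\<And>H X. H \<in> \<aa> \<Longrightarrow> X \<in> R \<Longrightarrow> \<exists>c. bracket H X = c *\<^sub>R X"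
    using iwasawa by (elim iwasawa_decompositionE) blast
  have negA: "- X \<in> \<aa>" if "X \<in> \<aa>" for X using I(3) that by (rule subspace_neg)
  obtain a n where an: "a \<in> A" "n \<in> N" "s = a ** n" using assms by (auto simp: set_mult_def)
  obtain a' where a': "a' \<in> A" "a ** a' = mat 1" "a' ** a = mat 1"
    using analytic_subgroup_inverse[of a \<aa>] negA an(1) I(1) by blast
  obtain n' where n': "n' \<in> N" "n ** n' = mat 1" "n' ** n = mat 1"
    using analytic_subgroup_inverse[of n "span R"] an(2) I(2) span_neg by blast
  have "a ** n' ** a' \<in> N"
    using analytic_subgroup_normalizes[OF I(4) negA, of _ a n' a'] an a' n' I(1,2) by blast
  moreover have "n' ** a' = a' ** (a ** n' ** a')"
    using a'(3) by (metis matrix_mul_assoc matrix_mul_lid)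
  ultimately have "n' ** a' \<in> set_mult A N"
    using a'(1) by (auto simp: set_mult_def)
  moreover have "s ** (n' ** a') = mat 1"
    unfolding an(3) using a' n' by (metis matrix_mul_assoc matrix_mul_rid)
  ultimately show ?thesis
    using that by (simp add: matrix_left_right_inverse)
qed

text \<open>The factor \<open>n\<close> is moved past \<open>b\<close> by conjugation, which keeps
  it in \<open>N\<close>.\<close>

lemma AN_mult:
  assumes "s \<in> set_mult A N" "t \<in> set_mult A N"
  shows "s ** t \<in> set_mult A N"
proof -
  obtain \<kk> \<aa> R where I: "A = analytic_subgroup \<aa>" "N = analytic_subgroup (span R)" "subspace \<aa>"
    "\<And>H X. H \<in> \<aa> \<Longrightarrow> X \<in> R \<Longrightarrow> \<exists>c. bracket H X = c *\<^sub>R X"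
    using iwasawa by (elim iwasawa_decompositionE) blast
  have negA: "- X \<in> \<aa>" if "X \<in> \<aa>" for X using I(3) that by (rule subspace_neg)
  obtain a n b m where *: "a \<in> A" "n \<in> N" "s = a ** n" "b \<in> A" "m \<in> N" "t = b ** m"
    using assms by (auto simp: set_mult_def)
  obtain b' where b': "b' \<in> A" "b ** b' = mat 1" "b' ** b = mat 1"
    using analytic_subgroup_inverse[of b \<aa>] negA *(4) I(1) by blast
  have "b' ** n ** b \<in> N"
    using analytic_subgroup_normalizes[OF I(4) negA, of _ b' n b] *(2) b' I(1,2) by blast
  then have "b' ** n ** b ** m \<in> N" "a ** b \<in> A"
    using * I(1,2) by (auto intro: analytic_subgroup_mult)
  moreover have "s ** t = (a ** b) ** (b' ** n ** b ** m)"
    unfolding *(3,6) using b'(2) by (metis matrix_mul_assoc matrix_mul_rid)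
  ultimately show ?thesis by (auto simp: set_mult_def)
qed

end

text \<open>
  Products of elements are joined to the identity by pointwise products of curves, so that no
  concatenation of paths is needed.
\<close>

definition mcurve :: "(real^'n^'n) set \<Rightarrow> (real \<Rightarrow> real^'n^'n) \<Rightarrow> bool" where
  "mcurve G c \<longleftrightarrow> c C1_differentiable_on UNIV \<and> range c \<subseteq> G \<and> c 0 = mat 1"

lemma C1_differentiable_on_matrix_mult:
  fixes f :: "real \<Rightarrow> real^'n^'m" and g :: "real \<Rightarrow> real^'k^'n"
  assumes "f C1_differentiable_on S" "g C1_differentiable_on S"
  shows "(\<lambda>t. f t ** g t) C1_differentiable_on S"
proof -
  obtain D E where D: "\<And>x. x \<in> S \<Longrightarrow> (f has_vector_derivative D x) (at x)" "continuous_on S D"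
    and E: "\<And>x. x \<in> S \<Longrightarrow> (g has_vector_derivative E x) (at x)" "continuous_on S E"
    using assms by (auto simp: C1_differentiable_on_def)
  have cont: "continuous_on S f" "continuous_on S g"
    using D E by (meson continuous_at_imp_continuous_on has_vector_derivative_continuous)+
  show ?thesis
    unfolding C1_differentiable_on_def
  proof (intro exI[of _ "\<lambda>x. f x ** E x + D x ** g x"] conjI ballI)
    show "((\<lambda>t. f t ** g t) has_vector_derivative f x ** E x + D x ** g x) (at x)" if "x \<in> S" for x
      by (rule bounded_bilinear.has_vector_derivative[OF bounded_bilinear_matrix_mult D(1)[OF that] E(1)[OF that]])
    show "continuous_on S (\<lambda>x. f x ** E x + D x ** g x)"
      by (intro continuous_intros bounded_bilinear.continuous_on[OF bounded_bilinear_matrix_mult] D E cont)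
  qed
qed

lemma has_vector_derivative_matrixI:
  fixes f :: "real \<Rightarrow> real^'n^'m"
  assumes "\<And>i j. ((\<lambda>t. f t $ i $ j) has_real_derivative D $ i $ j) (at x)"
  shows "(f has_vector_derivative D) (at x)"
  unfolding has_vector_derivative_def has_derivative_componentwise_within[of f]
proof
  fix b :: "real^'n^'m" assume "b \<in> Basis"
  then obtain i j where "b = axis i (axis j 1)"
    by (auto simp: Basis_vec_def)
  then have b: "M \<bullet> b = M $ i $ j" for M
    by (simp add: inner_axis)
  show "((\<lambda>t. f t \<bullet> b) has_derivative (\<lambda>h. (h *\<^sub>R D) \<bullet> b)) (at x)"
    unfolding b using assms[of i j] by (simp add: has_field_derivative_def mult_commute_abs)
qed

text \<open>Each entry is a power series in \<open>t\<close> converging everywhere, so it may be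
  differentiated termwise, and the derived series again converges everywhere and is
  continuous.\<close>

lemma C1_differentiable_mexp: "(\<lambda>t. mexp (t *\<^sub>R (X::real^'n^'n))) C1_differentiable_on UNIV"
proof -
  define a where "a i j n = (1 / fact n) * mpow X n $ i $ j" for i j n
  have "(\<lambda>n. a i j n * t ^ n) sums (mexp (t *\<^sub>R X) $ i $ j)" for i j t
    using bounded_linear.sums[OF bounded_linear_matrix_entry mexp_sums[of "t *\<^sub>R X"], of i j]
    by (simp add: a_def mpow_scale mult_ac)
  then have entry: "mexp (t *\<^sub>R X) $ i $ j = (\<Sum>n. a i j n * t ^ n)"
    and smm: "summable (\<lambda>n. a i j n * t ^ n)" for i j t
    by (simp_all add: sums_iff)
  have smm': "summable (\<lambda>n. diffs (a i j) n * t ^ n)" for i j t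
    using termdiff_converges_all[of "a i j" t] smm by blast
  define D where "D t = (\<chi> i j. \<Sum>n. diffs (a i j) n * t ^ n)" for t
  have "((\<lambda>t. mexp (t *\<^sub>R X) $ i $ j) has_real_derivative D t $ i $ j) (at t)" for i j t
    unfolding entry D_def by (simp add: termdiffs_strong_converges_everywhere[OF smm])
  then have "((\<lambda>t. mexp (t *\<^sub>R X)) has_vector_derivative D t) (at t)" for t
    by (rule has_vector_derivative_matrixI)
  moreover have "continuous_on UNIV D"
    unfolding D_def
    by (intro continuous_intros continuous_at_imp_continuous_on ballI
        DERIV_isCont[OF termdiffs_strong_converges_everywhere[OF smm']])
  ultimately show ?thesis by (auto simp: C1_differentiable_on_def)
qed

lemma analytic_subgroup_mcurve:
  assumes "g \<in> analytic_subgroup h" "\<And>X t. X \<in> h \<Longrightarrow> mexp (t *\<^sub>R X) \<in> G"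
    and one: "mat 1 \<in> G" and mult: "\<And>x y. x \<in> G \<Longrightarrow> y \<in> G \<Longrightarrow> x ** y \<in> G"
  shows "\<exists>c. mcurve G c \<and> c 1 = g"
  using assms(1)
proof induction
  case one
  show ?case by (rule exI[of _ "\<lambda>_. mat 1"]) (simp add: mcurve_def assms(3))
next
  case (mult_exp g X)
  then obtain c where "mcurve G c" "c 1 = g" by blast
  then show ?case
    using mult_exp assms(2) mult
    by (intro exI[of _ "\<lambda>t. c t ** mexp (t *\<^sub>R X)"])
      (auto simp: mcurve_def mexp_0 intro!: C1_differentiable_on_matrix_mult C1_differentiable_mexp)
qed

text \<open>An Iwasawa decomposition thus makes \<open>G\<close> path connected. Lower bounds on
  \<open>riemannian_dist\<close> rely on this: the infimum over an empty set of curves would carry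
  no information.\<close>

lemma iwasawa_mcurve:
  assumes iw: "iwasawa_decomposition G K A N" and "g \<in> G"
    and one: "mat 1 \<in> G" and mult: "\<And>x y. x \<in> G \<Longrightarrow> y \<in> G \<Longrightarrow> x ** y \<in> G"
  shows "\<exists>c. mcurve G c \<and> c 1 = g"
proof -
  obtain \<kk> \<aa> R where I: "K = analytic_subgroup \<kk>" "A = analytic_subgroup \<aa>" "N = analytic_subgroup (span R)"
    "\<And>X t. X \<in> \<kk> \<Longrightarrow> mexp (t *\<^sub>R X) \<in> G" "subspace \<aa>"
    using iw by (elim iwasawa_decompositionE) blast
  obtain k a n where g: "k \<in> K" "a \<in> A" "n \<in> N" "g = k ** (a ** n)"
    using iwasawa_factor[OF iw \<open>g \<in> G\<close>] unfolding set_mult_def by blast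
  \<comment> \<open>With the identity in the other two places of the decomposition, the
    one-parameter subgroups of \<open>A\<close>, and likewise those of \<open>N\<close>, lie in
    \<open>G\<close>.\<close>
  have AG: "mexp (t *\<^sub>R X) \<in> G" if "X \<in> \<aa>" for X t
    using iwasawa_mult_in[OF iw iwasawa_one(1)[OF iw] _ iwasawa_one(3)[OF iw], of "mexp (t *\<^sub>R X)"] that I
    by (simp add: subspace_mul mexp_in_analytic_subgroup)
  have NG: "mexp (t *\<^sub>R X) \<in> G" if "X \<in> span R" for X t
    using iwasawa_mult_in[OF iw iwasawa_one(1)[OF iw] iwasawa_one(2)[OF iw], of "mexp (t *\<^sub>R X)"] that I
    by (simp add: span_mul mexp_in_analytic_subgroup)
  obtain c1 c2 c3 where "mcurve G c1" "c1 1 = k" "mcurve G c2" "c2 1 = a" "mcurve G c3" "c3 1 = n"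
    using analytic_subgroup_mcurve[OF _ _ one mult] g(1-3) I AG NG by (metis (no_types, lifting))
  then show ?thesis
    using mult g(4) unfolding mcurve_def image_subset_iff
    by (intro exI[of _ "\<lambda>t. c1 t ** (c2 t ** c3 t)"])
      (auto intro!: C1_differentiable_on_matrix_mult)
qed

section \<open>Lengths of curves\<close>

text \<open>A function whose derivative is dominated by the length of tangent vectors cannot grow
  faster than arc length: integrate its derivative along the curve.\<close>

lemma curve_length_ge:
  fixes c :: "real \<Rightarrow> 'a::real_normed_vector" and u :: "'a \<Rightarrow> real"
  assumes c: "valid_path c" "path_image c \<subseteq> M"
    and L: "((\<lambda>t. F (c t) (vector_derivative c (at t))) has_integral L) {0..1}"
    and u: "\<And>x. x \<in> M \<Longrightarrow> (u has_derivative u' x) (at x)"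
    and le: "\<And>x v. x \<in> M \<Longrightarrow> u' x v \<le> F x v"
  shows "u (pathfinish c) - u (pathstart c) \<le> L"
proof -
  obtain S where S: "finite S" "c C1_differentiable_on ({0..1} - S)" "continuous_on {0..1} c"
    using c(1) by (auto simp: valid_path_def piecewise_C1_differentiable_on_def)
  have cM: "c t \<in> M" if "t \<in> {0..1}" for t
    using c(2) that by (auto simp: path_image_def)
  have "((\<lambda>t. u' (c t) (vector_derivative c (at t))) has_integral (u (c 1) - u (c 0))) {0..1}"
  \<comment> \<open>At the finitely many break points in \<open>S\<close>, continuity suffices for
    the fundamental theorem.\<close>
  proof (rule fundamental_theorem_of_calculus_interior_strong[OF S(1)])
    fix t :: real assume t: "t \<in> {0<..<1} - S"
    then have "(c has_vector_derivative vector_derivative c (at t)) (at t)"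
      using S(2) by (auto simp: C1_differentiable_on_eq vector_derivative_works[symmetric])
    then have c': "(c has_derivative (\<lambda>h. h *\<^sub>R vector_derivative c (at t))) (at t)"
      by (simp add: has_vector_derivative_def)
    have u'': "(u has_derivative u' (c t)) (at (c t))" using u cM t by auto
    have "linear (u' (c t))" using u'' by (rule has_derivative_linear)
    then show "((\<lambda>t. u (c t)) has_vector_derivative u' (c t) (vector_derivative c (at t))) (at t)"
      using has_derivative_compose[OF c' u''] by (simp add: has_vector_derivative_def linear_scale)
  next
    have "continuous_on M u"
      using u by (meson continuous_at_imp_continuous_on has_derivative_continuous)
    then show "continuous_on {0..1} (\<lambda>t. u (c t))"
      by (rule continuous_on_compose2[OF _ S(3)]) (use cM in auto)
  qed simp
  from has_integral_le[OF this L] le cM show ?thesis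
    by (simp add: pathstart_def pathfinish_def)
qed

text \<open>The curve \<open>c\<close> makes the set of lengths nonempty; the bound comes from
  \<open>curve_length_ge\<close>, applied to an arbitrary competitor.\<close>

lemma riemannian_dist_ge:
  assumes "valid_path c" "path_image c \<subseteq> M" "pathstart c \<in> S" "pathfinish c \<in> T"
    "(\<lambda>t. F (c t) (vector_derivative c (at t))) integrable_on {0..1}"
    and u: "\<And>x. x \<in> M \<Longrightarrow> (u has_derivative u' x) (at x)"
    and le: "\<And>x v. x \<in> M \<Longrightarrow> u' x v \<le> F x v"
    and b: "\<And>x y. x \<in> S \<Longrightarrow> y \<in> T \<Longrightarrow> b \<le> u y - u x"
  shows "b \<le> riemannian_dist M F S T"
  unfolding riemannian_dist_def
proof (rule cInf_greatest)
  show "{L. \<exists>c. valid_path c \<and> path_image c \<subseteq> M \<and> pathstart c \<in> S \<and> pathfinish c \<in> T \<and>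
      ((\<lambda>t. F (c t) (vector_derivative c (at t))) has_integral L) {0..1}} \<noteq> {}"
    using assms(1-5) by (auto simp: integrable_on_def)
next
  fix L assume "L \<in> {L. \<exists>c. valid_path c \<and> path_image c \<subseteq> M \<and> pathstart c \<in> S \<and> pathfinish c \<in> T \<and>
      ((\<lambda>t. F (c t) (vector_derivative c (at t))) has_integral L) {0..1}}"
  then obtain c where c: "valid_path c" "path_image c \<subseteq> M" "pathstart c \<in> S" "pathfinish c \<in> T"
      "((\<lambda>t. F (c t) (vector_derivative c (at t))) has_integral L) {0..1}" by blast
  show "b \<le> L"
    using curve_length_ge[OF c(1,2,5) u le] b[OF c(3,4)] by linarith
qed

text \<open>At constant speed \<open>L\<close> over unit time the length is \<open>L\<close>.
  Nonnegativity of \<open>F\<close> bounds all lengths below, so the infimum is at most each of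
  them.\<close>

lemma riemannian_dist_le:
  assumes "c C1_differentiable_on UNIV" "range c \<subseteq> M" "c 0 \<in> S" "c 1 \<in> T"
    "\<And>t. F (c t) (vector_derivative c (at t)) = L"
    and "\<And>x v. x \<in> M \<Longrightarrow> F x v \<ge> 0"
  shows "riemannian_dist M F S T \<le> L"
  unfolding riemannian_dist_def
proof (rule cInf_lower)
  have "valid_path c"
    using assms(1) C1_differentiable_imp_piecewise C1_differentiable_on_subset
    unfolding valid_path_def by blast
  then show "L \<in> {L. \<exists>c. valid_path c \<and> path_image c \<subseteq> M \<and> pathstart c \<in> S \<and> pathfinish c \<in> T \<and>
      ((\<lambda>t. F (c t) (vector_derivative c (at t))) has_integral L) {0..1}}"
    using assms(2-5) has_integral_const_real[of L 0 1]
    by (intro CollectI exI[of _ c]) (auto simp: path_image_def pathstart_def pathfinish_def)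
  show "bdd_below {L. \<exists>c. valid_path c \<and> path_image c \<subseteq> M \<and> pathstart c \<in> S \<and> pathfinish c \<in> T \<and>
      ((\<lambda>t. F (c t) (vector_derivative c (at t))) has_integral L) {0..1}}"
  proof (rule bdd_belowI[of _ 0], clarify)
    fix L c assume c: "path_image c \<subseteq> M" "((\<lambda>t. F (c t) (vector_derivative c (at t))) has_integral L) {0..1}"
    show "0 \<le> L"
      by (rule has_integral_nonneg[OF c(2)]) (use c(1) assms(6) in \<open>auto simp: path_image_def image_subset_iff\<close>)
  qed
qed

section \<open>The hyperbolic plane\<close>

definition m2 :: "real \<Rightarrow> real \<Rightarrow> real \<Rightarrow> real \<Rightarrow> real^2^2" where
  "m2 a b c d = (\<chi> i j. if i = 1 then if j = 1 then a else b else if j = 1 then c else d)"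

lemma m2_nth [simp]: "m2 a b c d $ 1 $ 1 = a" "m2 a b c d $ 1 $ 2 = b"
  "m2 a b c d $ 2 $ 1 = c" "m2 a b c d $ 2 $ 2 = d"
  by (simp_all add: m2_def)

lemma m2_eta: "A = m2 (A $ 1 $ 1) (A $ 1 $ 2) (A $ 2 $ 1) (A $ 2 $ 2)"
  by (simp add: vec_eq_iff forall_2)

lemma m2_mult: "m2 a b c d ** m2 a' b' c' d' =
    m2 (a * a' + b * c') (a * b' + b * d') (c * a' + d * c') (c * b' + d * d')"
  by (simp add: vec_eq_iff forall_2 matrix_matrix_mult_def sum_2)

lemma transpose_m2: "transpose (m2 a b c d) = m2 a c b d"
  by (simp add: vec_eq_iff forall_2 transpose_def)

lemma mat_1_m2: "mat 1 = m2 1 0 0 1"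
  by (simp add: vec_eq_iff forall_2 mat_def)

lemma m2_eq_iff: "m2 a b c d = m2 a' b' c' d' \<longleftrightarrow> a = a' \<and> b = b' \<and> c = c' \<and> d = d'"
  by (auto simp add: vec_eq_iff forall_2)

lemma det_m2: "det (m2 a b c d) = a * d - b * c"
  by (simp add: det_2)

lemma norm_m2: "(norm (m2 a b c d))\<^sup>2 = a\<^sup>2 + b\<^sup>2 + c\<^sup>2 + d\<^sup>2"
  by (simp add: power2_norm_eq_inner inner_vec_def sum_2) (simp add: power2_eq_square)

lemma inner_matrix_mult_right:
  fixes A :: "real^'k^'m" and B :: "real^'n^'m" and C :: "real^'k^'n"
  shows "A \<bullet> (B ** C) = (transpose B ** A) \<bullet> C"
proof -
  have "A \<bullet> (B ** C) = (\<Sum>i\<in>UNIV. \<Sum>j\<in>UNIV. \<Sum>k\<in>UNIV. A $ i $ j * (B $ i $ k * C $ k $ j))"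
    by (simp add: inner_vec_def matrix_matrix_mult_def sum_distrib_left)
  also have "\<dots> = (\<Sum>i\<in>UNIV. \<Sum>k\<in>UNIV. \<Sum>j\<in>UNIV. A $ i $ j * (B $ i $ k * C $ k $ j))"
    by (intro sum.cong refl sum.swap)
  also have "\<dots> = (\<Sum>k\<in>UNIV. \<Sum>i\<in>UNIV. \<Sum>j\<in>UNIV. A $ i $ j * (B $ i $ k * C $ k $ j))"
    by (rule sum.swap)
  also have "\<dots> = (\<Sum>k\<in>UNIV. \<Sum>j\<in>UNIV. \<Sum>i\<in>UNIV. A $ i $ j * (B $ i $ k * C $ k $ j))"
    by (intro sum.cong refl sum.swap)
  also have "\<dots> = (transpose B ** A) \<bullet> C"
    by (simp add: inner_vec_def matrix_matrix_mult_def sum_distrib_left sum_distrib_right transpose_def mult_ac)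
  finally show ?thesis .
qed

lemma norm_orthogonal_mult:
  fixes k A B :: "real^'n^'n"
  assumes "orthogonal_matrix k"
  shows "norm (k ** A) = norm A" and "norm (B ** k) = norm B"
proof -
  have *: "norm (u ** A) = norm A" if "orthogonal_matrix u" for u A :: "real^'n^'n"
    using that by (simp add: norm_eq_sqrt_inner inner_matrix_mult_right matrix_mul_assoc
        orthogonal_matrix_def)
  show "norm (k ** A) = norm A" by (rule *[OF assms])
  have "norm (B ** k) = norm (transpose k ** transpose B)"
    by (simp add: norm_transpose flip: matrix_transpose_mul)
  then show "norm (B ** k) = norm B"
    using *[of "transpose k" "transpose B"] assms by (simp add: norm_transpose orthogonal_matrix_transpose)
qed

text \<open>Singular value decomposition within \<open>SL(2,R)\<close>. A rotation on the left makes
  the rows orthogonal; determinant 1 makes their lengths reciprocal, and the normalized rows form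
  \<open>k'\<close>. The final bound holds because the squared norm is
  \<open>exp (2 * r) + exp (2 * (- r))\<close>.\<close>

lemma SL2_KAK:
  fixes m :: "real^2^2"
  assumes "det m = 1"
  obtains k r k' where "orthogonal_matrix k" "det k = 1" "orthogonal_matrix k'" "det k' = 1"
    "m = k ** m2 (exp r) 0 0 (exp (- r)) ** k'" "2 * \<bar>r\<bar> \<le> ln ((norm m)\<^sup>2)"
proof -
  define a b c d where "a = m $ 1 $ 1" "b = m $ 1 $ 2" "c = m $ 2 $ 1" "d = m $ 2 $ 2"
  have m: "m = m2 a b c d" unfolding a_b_c_d_def by (rule m2_eta)
  have det: "a * d - b * c = 1" using assms by (simp add: m det_m2)
  \<comment> \<open>The off-diagonal entry of \<open>m ** transpose m\<close> and half the
    difference of its diagonal entries rotate through the double angle; \<open>\<theta>\<close> is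
    chosen to annul the rotated off-diagonal entry.\<close>
  obtain \<rho> t where polar: "a * c + b * d = \<rho> * cos t" "(c\<^sup>2 + d\<^sup>2 - a\<^sup>2 - b\<^sup>2) / 2 = \<rho> * sin t"
    using polar_Ex by blast
  define \<theta> where "\<theta> = (t + pi / 2) / 2"
  define C S where "C = cos \<theta>" "S = sin \<theta>"
  have CS: "C\<^sup>2 + S\<^sup>2 = 1" by (simp add: C_S_def)
  have double: "2 * \<theta> = t + pi / 2" by (simp add: \<theta>_def)
  have "C\<^sup>2 - S\<^sup>2 = - sin t" "2 * S * C = cos t"
    using cos_double[of \<theta>] sin_double[of \<theta>] unfolding double
    by (simp_all add: C_S_def cos_add sin_add)
  then have orth0: "(C\<^sup>2 - S\<^sup>2) * (a * c + b * d) + S * C * (c\<^sup>2 + d\<^sup>2 - a\<^sup>2 - b\<^sup>2) = 0"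
  proof -
    have "S * C * (c\<^sup>2 + d\<^sup>2 - a\<^sup>2 - b\<^sup>2) = (2 * S * C) * ((c\<^sup>2 + d\<^sup>2 - a\<^sup>2 - b\<^sup>2) / 2)" by simp
    then show ?thesis unfolding polar \<open>C\<^sup>2 - S\<^sup>2 = - sin t\<close> \<open>2 * S * C = cos t\<close> by simp
  qed
  \<comment> \<open>The rows of \<open>transpose k ** m\<close>, with the rotation \<open>k\<close>
    defined below.\<close>
  define p q p' q' where "p = C * a + S * c" "q = C * b + S * d" "p' = - S * a + C * c" "q' = - S * b + C * d"
  note pq = p_q_p'_q'_def
  have orth: "p * p' + q * q' = 0"
    using orth0 unfolding pq by (simp add: algebra_simps power2_eq_square)
  have det': "p * q' - q * p' = 1"
  proof -
    have "p * q' - q * p' = (C\<^sup>2 + S\<^sup>2) * (a * d - b * c)"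
      unfolding pq by (simp add: algebra_simps power2_eq_square)
    then show ?thesis using CS det by simp
  qed
  \<comment> \<open>Lagrange's identity: orthogonal rows and determinant 1 give reciprocal row
    lengths.\<close>
  have prod: "(p\<^sup>2 + q\<^sup>2) * (p'\<^sup>2 + q'\<^sup>2) = 1"
  proof -
    have "(p\<^sup>2 + q\<^sup>2) * (p'\<^sup>2 + q'\<^sup>2) = (p * p' + q * q')\<^sup>2 + (p * q' - q * p')\<^sup>2"
      by (simp add: algebra_simps power2_eq_square)
    then show ?thesis using orth det' by simp
  qed
  define l where "l = sqrt (p\<^sup>2 + q\<^sup>2)"
  have "p\<^sup>2 + q\<^sup>2 \<noteq> 0" using prod by auto
  then have l: "l > 0" "l\<^sup>2 = p\<^sup>2 + q\<^sup>2"
    by (simp_all add: l_def sum_power2_gt_zero_iff)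
  define r where "r = ln l"
  have er: "exp r = l" "exp (- r) = 1 / l" using l(1) by (simp_all add: r_def exp_minus field_simps)
  define k k' where "k = m2 C (- S) S C" "k' = m2 (p / l) (q / l) (p' * l) (q' * l)"
  have k: "orthogonal_matrix k" "det k = 1"
    using CS by (simp_all add: orthogonal_matrix k_k'_def transpose_m2 m2_mult mat_1_m2 m2_eq_iff det_m2
        power2_eq_square mult.commute add.commute)
  have "p / l * (p / l) + q / l * (q / l) = 1"
  proof -
    have "p / l * (p / l) + q / l * (q / l) = (p * p + q * q) / (l * l)"
      by (simp add: add_divide_distrib)
    also have "p * p + q * q = l * l" using l(2) by (simp add: power2_eq_square)
    finally show ?thesis using l(1) by simp
  qed
  moreover have "(p' * l) * (p' * l) + (q' * l) * (q' * l) = 1"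
  proof -
    have "(p' * l) * (p' * l) + (q' * l) * (q' * l) = l\<^sup>2 * (p'\<^sup>2 + q'\<^sup>2)"
      by (simp add: algebra_simps power2_eq_square)
    then show ?thesis using prod l(2) by simp
  qed
  moreover have "p / l * (p' * l) + q / l * (q' * l) = 0" "p / l * (q' * l) - q / l * (p' * l) = 1"
    using l(1) orth det' by simp_all
  ultimately have k': "orthogonal_matrix k'" "det k' = 1"
    unfolding orthogonal_matrix_def matrix_left_right_inverse[of "transpose k'" k']
    by (simp_all add: k_k'_def transpose_m2 m2_mult mat_1_m2 m2_eq_iff det_m2 mult_ac)
  have comb: "C * (C * x + S * y) - S * (- S * x + C * y) = x"
    "S * (C * x + S * y) + C * (- S * x + C * y) = y" for x y
  proof -
    have "C * (C * x + S * y) - S * (- S * x + C * y) = (C\<^sup>2 + S\<^sup>2) * x"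
      "S * (C * x + S * y) + C * (- S * x + C * y) = (C\<^sup>2 + S\<^sup>2) * y"
      by (simp_all add: algebra_simps power2_eq_square)
    then show "C * (C * x + S * y) - S * (- S * x + C * y) = x"
      "S * (C * x + S * y) + C * (- S * x + C * y) = y" using CS by simp_all
  qed
  have mk: "m = k ** m2 (exp r) 0 0 (exp (- r)) ** k'"
  proof -
    have "C * p - S * p' = a" "C * q - S * q' = b" "S * p + C * p' = c" "S * q + C * q' = d"
      using comb[of a c] comb[of b d] by (simp_all add: pq)
    then show ?thesis
      using l(1) unfolding er k_k'_def m m2_mult m2_eq_iff by simp
  qed
  have "(norm m)\<^sup>2 = (norm (m2 (exp r) 0 0 (exp (- r))))\<^sup>2"
    unfolding mk using k k' by (simp add: norm_orthogonal_mult)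
  also have "\<dots> = exp (2 * r) + exp (2 * (- r))"
    unfolding norm_m2 exp_double by simp
  finally have n: "(norm m)\<^sup>2 = exp (2 * r) + exp (2 * (- r))" .
  have "2 * \<bar>r\<bar> = ln (exp (2 * \<bar>r\<bar>))" by simp
  also have "\<dots> \<le> ln ((norm m)\<^sup>2)"
    unfolding n by (intro ln_mono) (auto simp: abs_if add_pos_pos)
  finally show ?thesis using that k k' mk by blast
qed

text \<open>\<open>Q z w\<close> is twice the hyperbolic cosine of the distance of \<open>z\<close> and \<open>w\<close>.\<close>

definition Q :: "complex \<Rightarrow> complex \<Rightarrow> real" where
  "Q z w = ((Re z - Re w)\<^sup>2 + (Im z)\<^sup>2 + (Im w)\<^sup>2) / (Im z * Im w)"

lemma Q_alt:
  assumes "z \<in> H2" "w \<in> H2"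
  shows "Q z w = (cmod (z - w))\<^sup>2 / (Im z * Im w) + 2"
  unfolding cmod_power2
  using assms by (simp add: Q_def H2_def field_simps) (simp add: algebra_simps power2_eq_square)

lemma Q_ge_2: "z \<in> H2 \<Longrightarrow> w \<in> H2 \<Longrightarrow> Q z w \<ge> 2"
  by (simp add: Q_alt H2_def)

lemma Q_self: "z \<in> H2 \<Longrightarrow> Q z z = 2"
  by (simp add: Q_alt)

text \<open>For \<open>z\<close> in \<open>H2\<close> this is the upper triangular matrix with
  positive diagonal carrying \<open>\<i>\<close> to \<open>z\<close>: a section of the orbit map at
  \<open>\<i>\<close>.\<close>

definition to_SL2 :: "complex \<Rightarrow> real^2^2" where
  "to_SL2 z = m2 (sqrt (Im z)) (Re z / sqrt (Im z)) 0 (1 / sqrt (Im z))"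

lemma det_to_SL2: "z \<in> H2 \<Longrightarrow> det (to_SL2 z) = 1"
  by (simp add: to_SL2_def det_m2 H2_def)

definition SL2_inv :: "real^2^2 \<Rightarrow> real^2^2" where
  "SL2_inv A = m2 (A $ 2 $ 2) (- A $ 1 $ 2) (- A $ 2 $ 1) (A $ 1 $ 1)"

lemma SL2_inv:
  assumes "det A = 1"
  shows "A ** SL2_inv A = mat 1" "SL2_inv A ** A = mat 1" "det (SL2_inv A) = 1"
proof -
  obtain a b c d where A: "A = m2 a b c d" using m2_eta by blast
  show "A ** SL2_inv A = mat 1" "SL2_inv A ** A = mat 1" "det (SL2_inv A) = 1"
    using assms by (simp_all add: A SL2_inv_def m2_mult mat_1_m2 m2_eq_iff det_m2 algebra_simps)
qed

text \<open>Links matrices to hyperbolic distance: the product carries \<open>\<i>\<close> to a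
  point at the distance \<open>d\<close> of \<open>z\<close> and \<open>w\<close>, so its squared
  singular values are \<open>exp d\<close> and \<open>exp (- d)\<close>, with sum twice the
  hyperbolic cosine.\<close>

lemma norm_to_SL2:
  assumes "z \<in> H2" "w \<in> H2"
  shows "(norm (SL2_inv (to_SL2 z) ** to_SL2 w))\<^sup>2 = Q z w"
proof -
  have y: "Im z > 0" "Im w > 0" using assms by (auto simp: H2_def)
  have "(norm (SL2_inv (to_SL2 z) ** to_SL2 w))\<^sup>2 =
     Im w / Im z + ((Re w - Re z) / (sqrt (Im z) * sqrt (Im w)))\<^sup>2 + Im z / Im w"
    using y by (simp add: SL2_inv_def to_SL2_def m2_mult norm_m2 power_divide diff_divide_distrib mult.commute)
  also have "\<dots> = Q z w"
    using y by (simp add: Q_def power_divide power_mult_distrib field_simps power2_eq_square)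
  finally show ?thesis .
qed

lemma moebius_denominator:
  fixes A :: "real^2^2"
  assumes "det A = 1" "z \<in> H2"
  shows "of_real (A $ 2 $ 1) * z + of_real (A $ 2 $ 2) \<noteq> (0::complex)"
proof
  assume 0: "of_real (A $ 2 $ 1) * z + of_real (A $ 2 $ 2) = (0::complex)"
  from arg_cong[OF 0, of Im] have "A $ 2 $ 1 = 0" using assms(2) by (simp add: H2_def)
  moreover from arg_cong[OF 0, of Re] have "A $ 2 $ 2 = 0" using calculation by simp
  ultimately show False using assms(1) by (simp add: det_2)
qed

lemma SL2_act_mult:
  assumes "det B = 1" "z \<in> H2"
  shows "SL2_act (A ** B) z = SL2_act A (SL2_act B z)"
  using moebius_denominator[OF assms]
  unfolding SL2_act_def moebius_def
  by (simp add: matrix_matrix_mult_def sum_2 divide_simps) (simp add: algebra_simps)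

lemma SL2_act_one: "SL2_act (mat 1) z = z"
  by (simp add: SL2_act_def moebius_def mat_1_m2)

lemma Im_SL2_act:
  assumes "det A = 1" "z \<in> H2"
  shows "Im (SL2_act A z) = Im z / (cmod (of_real (A $ 2 $ 1) * z + of_real (A $ 2 $ 2)))\<^sup>2"
proof -
  let ?N = "of_real (A $ 1 $ 1) * z + of_real (A $ 1 $ 2)" and ?D = "of_real (A $ 2 $ 1) * z + of_real (A $ 2 $ 2)"
  have "Im (SL2_act A z) = (Im ?N * Re ?D - Re ?N * Im ?D) / (cmod ?D)\<^sup>2"
    unfolding SL2_act_def moebius_def Im_divide cmod_power2 by simp
  also have "Im ?N * Re ?D - Re ?N * Im ?D = det A * Im z"
    by (simp add: det_2 algebra_simps)
  finally show ?thesis using assms by simp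
qed

lemma SL2_act_H2: "det A = 1 \<Longrightarrow> z \<in> H2 \<Longrightarrow> SL2_act A z \<in> H2"
  using moebius_denominator[of A z] by (simp add: H2_def Im_SL2_act)

text \<open>The denominators in the difference of the images cancel against those in the imaginary
  parts.\<close>

lemma Q_SL2_act:
  assumes "det A = 1" "z \<in> H2" "w \<in> H2"
  shows "Q (SL2_act A z) (SL2_act A w) = Q z w"
proof -
  define D where "D z = complex_of_real (A $ 2 $ 1) * z + of_real (A $ 2 $ 2)" for z
  have D: "D z \<noteq> 0" "D w \<noteq> 0" using moebius_denominator assms by (auto simp: D_def)
  have "SL2_act A z - SL2_act A w = of_real (det A) * (z - w) / (D z * D w)"
    using D unfolding SL2_act_def moebius_def D_def[symmetric]
    by (simp add: divide_simps) (simp add: D_def det_2 algebra_simps)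
  then show ?thesis
    using D assms
    by (simp add: Q_alt SL2_act_H2 Im_SL2_act D_def[symmetric] norm_divide norm_mult power_divide power_mult_distrib)
qed

text \<open>The inverse is both the adjugate and the transpose; equating the two gives the shape of
  a rotation matrix.\<close>

lemma SL2_act_rotation:
  assumes "orthogonal_matrix k" "det k = 1"
  shows "SL2_act k \<i> = \<i>"
proof -
  have inv: "SL2_inv k = transpose k"
    using matrix_inv_eqI[OF SL2_inv(1)[OF assms(2)]] matrix_inv_eqI[of k "transpose k"] assms(1)
    by (simp add: orthogonal_matrix_def)
  have "k $ 1 $ 1 = k $ 2 $ 2" "k $ 1 $ 2 = - k $ 2 $ 1"
    using arg_cong[OF inv, of "\<lambda>m. m $ 1 $ 1"] arg_cong[OF inv, of "\<lambda>m. m $ 2 $ 1"]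
    by (simp_all add: SL2_inv_def transpose_def)
  then have "of_real (k $ 1 $ 1) * \<i> + of_real (k $ 1 $ 2) =
      \<i> * (of_real (k $ 2 $ 1) * \<i> + of_real (k $ 2 $ 2))"
    by (simp add: complex_eq_iff)
  then show ?thesis
    using moebius_denominator[OF assms(2), of \<i>]
    by (simp add: SL2_act_def moebius_def H2_def)
qed

lemma SL2_act_to_SL2: "z \<in> H2 \<Longrightarrow> SL2_act (to_SL2 z) \<i> = z"
  by (simp add: SL2_act_def moebius_def to_SL2_def H2_def complex_eq_iff)

lemma SL2_act_has_field_derivative:
  assumes "det A = 1" "z \<in> H2"
  shows "(SL2_act A has_field_derivative 1 / (of_real (A $ 2 $ 1) * z + of_real (A $ 2 $ 2))\<^sup>2) (at z)"
proof -
  let ?N = "of_real (A $ 1 $ 1) * z + of_real (A $ 1 $ 2)" and ?D = "of_real (A $ 2 $ 1) * z + of_real (A $ 2 $ 2)"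
  have "(SL2_act A has_field_derivative
      (of_real (A $ 1 $ 1) * ?D - ?N * of_real (A $ 2 $ 1)) / (?D * ?D)) (at z)"
    unfolding SL2_act_def[abs_def] moebius_def
    using moebius_denominator[OF assms] by (auto intro!: derivative_eq_intros)
  moreover have "of_real (A $ 1 $ 1) * ?D - ?N * of_real (A $ 2 $ 1) = of_real (det A)"
    by (simp add: det_2 algebra_simps)
  ultimately show ?thesis using assms by (simp add: power2_eq_square)
qed

text \<open>The geodesic is the image of a segment of the imaginary axis under
  \<open>A = to_SL2 z ** k\<close>, with \<open>k\<close> from the decomposition of
  \<open>m\<close>. As \<open>k\<close> and \<open>k'\<close> fix \<open>\<i>\<close>, its endpoints
  are \<open>z\<close> and the image of \<open>\<i>\<close> under \<open>to_SL2 z ** m\<close>,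
  which is \<open>w\<close>.\<close>

lemma H2_geodesic:
  assumes "z \<in> H2" "w \<in> H2"
  obtains c c' s where "\<And>t. (c has_vector_derivative c' t) (at t)" "continuous_on UNIV c'"
    "range c \<subseteq> H2" "c 0 = z" "c 1 = w" "\<And>t. H2_norm (c t) (c' t) = s" "0 \<le> s" "s \<le> ln (Q z w)"
proof -
  define m where "m = SL2_inv (to_SL2 z) ** to_SL2 w"
  have "det m = 1" using assms by (simp add: m_def det_mul SL2_inv det_to_SL2)
  then obtain k r k' where k: "orthogonal_matrix k" "det k = 1" "orthogonal_matrix k'" "det k' = 1"
    "m = k ** m2 (exp r) 0 0 (exp (- r)) ** k'" "2 * \<bar>r\<bar> \<le> ln ((norm m)\<^sup>2)"
    using SL2_KAK by metis
  define A where "A = to_SL2 z ** k"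
  define a where "a = m2 (exp r) 0 0 (exp (- r))"
  have A: "det A = 1" using assms k by (simp add: A_def det_mul det_to_SL2)
  have a: "det a = 1" by (simp add: a_def det_m2 flip: exp_add)
  have i: "\<i> \<in> H2" by (simp add: H2_def)
  \<comment> \<open>The orbit of \<open>\<i>\<close> under the diagonal matrices with entries
    \<open>exp (r * t)\<close> and \<open>exp (- (r * t))\<close>; its hyperbolic speed is
    \<open>2 * \<bar>r\<bar>\<close>.\<close>
  define e where "e t = of_real (exp (2 * r * t)) * \<i>" for t
  define e' where "e' t = of_real (2 * r * exp (2 * r * t)) * \<i>" for t
  have eH: "e t \<in> H2" for t by (simp add: H2_def e_def)
  define D where "D t = complex_of_real (A $ 2 $ 1) * e t + of_real (A $ 2 $ 2)" for t
  have D: "D t \<noteq> 0" for t unfolding D_def by (rule moebius_denominator[OF A eH])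
  have e': "(e has_vector_derivative e' t) (at t)" for t
    unfolding e_def e'_def
    by (auto intro!: derivative_eq_intros simp: has_real_derivative_iff_has_vector_derivative[symmetric])
  define c where "c t = SL2_act A (e t)" for t
  define c' where "c' t = e' t / (D t)\<^sup>2" for t
  have 1: "(c has_vector_derivative c' t) (at t)" for t
    using field_vector_diff_chain_at[OF e' SL2_act_has_field_derivative[OF A eH]]
    by (simp add: c_def[abs_def] c'_def D_def o_def)
  have 2: "continuous_on UNIV c'"
    unfolding c'_def D_def[abs_def] e_def e'_def
    by (intro continuous_intros) (use D in \<open>auto simp: D_def e_def\<close>)
  have 3: "range c \<subseteq> H2" by (auto simp: c_def intro!: SL2_act_H2 A eH)
  have 4: "c 0 = z"
    using SL2_act_mult[OF k(2) i, of "to_SL2 z"] k assms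
    by (simp add: c_def e_def A_def SL2_act_rotation SL2_act_to_SL2)
  have "e 1 = SL2_act a \<i>"
    by (simp add: e_def SL2_act_def moebius_def a_def exp_minus exp_double power2_eq_square field_simps)
      (simp add: mult.assoc[symmetric] flip: of_real_mult exp_add)
  also have "\<dots> = SL2_act a (SL2_act k' \<i>)" using k by (simp add: SL2_act_rotation)
  finally have "c 1 = SL2_act (A ** (a ** k')) \<i>"
    using k a i by (simp add: c_def SL2_act_mult det_mul SL2_act_H2)
  also have "A ** (a ** k') = to_SL2 z ** m"
    by (simp add: k(5) A_def a_def matrix_mul_assoc)
  also have "\<dots> = to_SL2 w"
    using assms by (simp add: m_def matrix_mul_assoc SL2_inv det_to_SL2)
  finally have 5: "c 1 = w" using assms by (simp add: SL2_act_to_SL2)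
  \<comment> \<open>The modulus of the derivative and the imaginary part acquire the same factor,
    the inverse square of \<open>cmod (D t)\<close>, so the speed is that of
    \<open>e\<close>.\<close>
  have 6: "H2_norm (c t) (c' t) = 2 * \<bar>r\<bar>" for t
  proof -
    have "Im (c t) = Im (e t) / (cmod (D t))\<^sup>2"
      unfolding c_def D_def by (rule Im_SL2_act[OF A eH])
    then show ?thesis
      using D[of t] by (simp add: H2_norm_def c'_def norm_divide norm_power e_def e'_def norm_mult abs_mult)
  qed
  have 7: "2 * \<bar>r\<bar> \<le> ln (Q z w)" using k(6) norm_to_SL2[OF assms] by (simp add: m_def)
  show ?thesis by (rule that[OF 1 2 3 4 5 6 _ 7]) simp
qed

text \<open>Provides the function that bounds distances below. The logarithm of the hyperbolic
  cosine of the distance has a gradient of length at most 1; estimating the two coordinate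
  directions separately costs the factor 2.\<close>

lemma H2_log_derivative:
  assumes "z \<in> H2" "w \<in> H2"
  obtains u' where "((\<lambda>z. ln (Q z w)) has_derivative u') (at z)" "\<And>v. u' v \<le> 2 * H2_norm z v"
proof -
  have y: "Im z > 0" "Im w > 0" using assms by (auto simp: H2_def)
  define N where "N z = (Re z - Re w)\<^sup>2 + (Im z)\<^sup>2 + (Im w)\<^sup>2" for z
  have N: "N z > 0" using y by (auto simp: N_def intro!: add_nonneg_pos)
  define u' where "u' v = (2 * (Re z - Re w) * Re v + 2 * Im z * Im v) / N z - Im v / Im z" for v
  have der: "((\<lambda>z. ln (N z) - ln (Im z) - ln (Im w)) has_derivative u') (at z)"
    using N y unfolding u'_def N_def
    by (auto intro!: derivative_eq_intros simp: fun_eq_iff field_simps)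
  have eq: "ln (N x) - ln (Im x) - ln (Im w) = ln (Q x w)" if "x \<in> H2" for x
  proof -
    have "N x > 0" "Im x > 0" using that y by (auto simp: N_def H2_def intro!: add_nonneg_pos)
    then show ?thesis using y(2) by (simp add: Q_def ln_div ln_mult N_def[symmetric])
  qed
  have "open H2" by (simp add: H2_def open_halfspace_Im_gt)
  from has_derivative_transform_within_open[OF der this assms(1) eq]
  have "((\<lambda>z. ln (Q z w)) has_derivative u') (at z)" .
  moreover have "u' v \<le> 2 * H2_norm z v" for v
  proof -
    define d where "d = Re z - Re w"
    have "2 * \<bar>d\<bar> * Im z \<le> N z"
      using sum_squares_bound[of "\<bar>d\<bar>" "Im z"] zero_le_power2[of "Im w"]
      unfolding N_def d_def[symmetric] power2_abs by linarith
    then have "(2 * \<bar>d\<bar>) / N z \<le> 1 / Im z"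
      using N y by (simp add: field_simps)
    then have "\<bar>Re v\<bar> * ((2 * \<bar>d\<bar>) / N z) \<le> \<bar>Re v\<bar> * (1 / Im z)"
      by (intro mult_left_mono) auto
    moreover have "(2 * d * Re v) / N z \<le> \<bar>(2 * d * Re v) / N z\<bar>" by (rule abs_ge_self)
    ultimately have 1: "(2 * d * Re v) / N z \<le> \<bar>Re v\<bar> / Im z"
      using N by (simp add: abs_mult mult_ac)
    \<comment> \<open>The coefficient of \<open>Im v / Im z\<close> lies between -1 and 1, because
      \<open>(Im z)\<^sup>2\<close> lies between 0 and \<open>N z\<close>.\<close>
    have "\<bar>2 * (Im z)\<^sup>2 - N z\<bar> \<le> N z" by (auto simp: N_def abs_if)
    then have "\<bar>(2 * (Im z)\<^sup>2 - N z) / N z\<bar> \<le> 1" using N by simp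
    then have "\<bar>(2 * (Im z)\<^sup>2 - N z) / N z\<bar> * (\<bar>Im v\<bar> / Im z) \<le> \<bar>Im v\<bar> / Im z"
      using y by (intro mult_left_le_one_le) auto
    moreover have "2 * Im z * Im v / N z - Im v / Im z = ((2 * (Im z)\<^sup>2 - N z) / N z) * (Im v / Im z)"
      using N y by (simp add: field_simps power2_eq_square)
    moreover have "((2 * (Im z)\<^sup>2 - N z) / N z) * (Im v / Im z) \<le> \<bar>((2 * (Im z)\<^sup>2 - N z) / N z) * (Im v / Im z)\<bar>"
      by (rule abs_ge_self)
    ultimately have 2: "2 * Im z * Im v / N z - Im v / Im z \<le> \<bar>Im v\<bar> / Im z"
      using y by (simp add: abs_mult)
    have "u' v \<le> \<bar>Re v\<bar> / Im z + \<bar>Im v\<bar> / Im z"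
      using 1 2 by (simp add: u'_def d_def[symmetric] add_divide_distrib)
    also have "\<dots> \<le> cmod v / Im z + cmod v / Im z"
      using y by (intro add_mono divide_right_mono) (auto simp: abs_Re_le_cmod abs_Im_le_cmod)
    finally show ?thesis by (simp add: H2_norm_def)
  qed
  ultimately show ?thesis using that by blast
qed

text \<open>For the upper bound the geodesics of the two factors are run simultaneously; the lower
  bound compares every curve with the growth of \<open>u\<close>.\<close>

lemma H2xH2_dist_bounds:
  assumes "p \<in> H2 \<times> H2" "q \<in> H2 \<times> H2"
  shows "H2xH2_dist p q \<le> ln (Q (fst p) (fst q)) + ln (Q (snd p) (snd q))"
    and "(ln (Q (fst p) (fst q)) + ln (Q (snd p) (snd q))) / 4 - ln 2 / 2 \<le> H2xH2_dist p q"
proof -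
  have H: "fst p \<in> H2" "snd p \<in> H2" "fst q \<in> H2" "snd q \<in> H2" using assms by auto
  obtain c1 c1' s1 where c1: "\<And>t. (c1 has_vector_derivative c1' t) (at t)" "continuous_on UNIV c1'"
    "range c1 \<subseteq> H2" "c1 0 = fst p" "c1 1 = fst q" "\<And>t. H2_norm (c1 t) (c1' t) = s1" "0 \<le> s1"
    "s1 \<le> ln (Q (fst p) (fst q))" using H2_geodesic[OF H(1,3)] by metis
  obtain c2 c2' s2 where c2: "\<And>t. (c2 has_vector_derivative c2' t) (at t)" "continuous_on UNIV c2'"
    "range c2 \<subseteq> H2" "c2 0 = snd p" "c2 1 = snd q" "\<And>t. H2_norm (c2 t) (c2' t) = s2" "0 \<le> s2"
    "s2 \<le> ln (Q (snd p) (snd q))" using H2_geodesic[OF H(2,4)] by metis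
  define c where "c t = (c1 t, c2 t)" for t
  have c': "(c has_vector_derivative (c1' t, c2' t)) (at t)" for t
    unfolding c_def by (intro has_vector_derivative_Pair c1 c2)
  have vd: "vector_derivative c (at t) = (c1' t, c2' t)" for t
    using c' by (rule vector_derivative_at)
  have C1: "c C1_differentiable_on UNIV"
    unfolding C1_differentiable_on_def using c'
    by (intro exI[of _ "\<lambda>t. (c1' t, c2' t)"]) (auto intro!: continuous_intros c1 c2)
  have ran: "range c \<subseteq> H2 \<times> H2" using c1(3) c2(3) by (auto simp: c_def)
  have speed: "H2xH2_norm (c t) (vector_derivative c (at t)) = sqrt (s1\<^sup>2 + s2\<^sup>2)" for t
    unfolding vd by (simp add: H2xH2_norm_def c_def c1 c2)
  have ends: "c 0 \<in> {p}" "c 1 \<in> {q}" by (simp_all add: c_def c1 c2)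
  have "H2xH2_dist p q \<le> sqrt (s1\<^sup>2 + s2\<^sup>2)"
    unfolding H2xH2_dist_def
    by (rule riemannian_dist_le[where F = H2xH2_norm, OF C1 ran ends speed]) (simp add: H2xH2_norm_def)
  also have "\<dots> \<le> s1 + s2" using c1(7) c2(7) by (rule sqrt_sum_squares_le_sum)
  finally show "H2xH2_dist p q \<le> ln (Q (fst p) (fst q)) + ln (Q (snd p) (snd q))"
    using c1(8) c2(8) by linarith
  \<comment> \<open>Each logarithm grows at most at twice the speed in the product, so dividing the
    sum by 4 makes it dominated by the metric. Its value at \<open>p\<close> is
    \<open>ln 2 / 2\<close>, the additive constant.\<close>
  define u where "u x = (ln (Q (fst x) (fst p)) + ln (Q (snd x) (snd p))) / 4" for x
  have "\<exists>u'. (u has_derivative u') (at x) \<and> (\<forall>v. u' v \<le> H2xH2_norm x v)" if x: "x \<in> H2 \<times> H2" for x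
  proof -
    have xH: "fst x \<in> H2" "snd x \<in> H2" using x by auto
    obtain u1 where u1: "((\<lambda>z. ln (Q z (fst p))) has_derivative u1) (at (fst x))" "\<And>v. u1 v \<le> 2 * H2_norm (fst x) v"
      using H2_log_derivative[OF xH(1) H(1)] by metis
    obtain u2 where u2: "((\<lambda>z. ln (Q z (snd p))) has_derivative u2) (at (snd x))" "\<And>v. u2 v \<le> 2 * H2_norm (snd x) v"
      using H2_log_derivative[OF xH(2) H(2)] by metis
    have "(u has_derivative (\<lambda>v. (u1 (fst v) + u2 (snd v)) / 4)) (at x)"
      unfolding u_def divide_inverse
      by (intro has_derivative_mult_left has_derivative_add
          has_derivative_compose[where f = fst, OF _ u1(1)] has_derivative_compose[where f = snd, OF _ u2(1)]
          bounded_linear_imp_has_derivative bounded_linear_fst bounded_linear_snd)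
    moreover have "(u1 (fst v) + u2 (snd v)) / 4 \<le> H2xH2_norm x v" for v
    proof -
      have "H2_norm (fst x) (fst v) \<le> H2xH2_norm x v" "H2_norm (snd x) (snd v) \<le> H2xH2_norm x v"
        unfolding H2xH2_norm_def by (auto intro!: real_le_rsqrt)
      then show ?thesis using u1(2)[of "fst v"] u2(2)[of "snd v"] by simp
    qed
    ultimately show ?thesis by blast
  qed
  then obtain u' where u': "\<And>x. x \<in> H2 \<times> H2 \<Longrightarrow> (u has_derivative u' x) (at x)"
    "\<And>x v. x \<in> H2 \<times> H2 \<Longrightarrow> u' x v \<le> H2xH2_norm x v" by metis
  show "(ln (Q (fst p) (fst q)) + ln (Q (snd p) (snd q))) / 4 - ln 2 / 2 \<le> H2xH2_dist p q"
    unfolding H2xH2_dist_def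
  proof (rule riemannian_dist_ge[where F = H2xH2_norm and u = u, OF _ _ _ _ _ u'])
    show "valid_path c"
      using C1 C1_differentiable_imp_piecewise C1_differentiable_on_subset unfolding valid_path_def by blast
    show "(\<lambda>t. H2xH2_norm (c t) (vector_derivative c (at t))) integrable_on {0..1}"
      unfolding speed by (rule integrable_const_ivl)
    have "Q z w = Q w z" for z w by (simp add: Q_def power2_commute mult.commute add_ac)
    then show "(ln (Q (fst p) (fst q)) + ln (Q (snd p) (snd q))) / 4 - ln 2 / 2 \<le> u y - u x"
      if "x \<in> {p}" "y \<in> {q}" for x y
      using that H by (simp add: u_def Q_self)
  qed (use ran ends in \<open>auto simp: path_image_def pathstart_def pathfinish_def\<close>)
qed

section \<open>The embedding of two copies of \<open>SL(2,R)\<close>\<close>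

lemma sum_UNIV_Plus:
  "(\<Sum>k\<in>(UNIV :: ('a::finite + 'b::finite) set). f k) = (\<Sum>k\<in>UNIV. f (Inl k)) + (\<Sum>k\<in>UNIV. f (Inr k))"
  by (simp add: UNIV_Plus_UNIV[symmetric] sum.Plus del: UNIV_Plus_UNIV)

lemma forall_2_plus_2: "(\<forall>i::2 + 2. P i) \<longleftrightarrow> P (Inl 1) \<and> P (Inl 2) \<and> P (Inr 1) \<and> P (Inr 2)"
proof (safe)
  fix i :: "2 + 2"
  assume "P (Inl 1)" "P (Inl 2)" "P (Inr 1)" "P (Inr 2)"
  then have "\<forall>j. P (Inl j)" "\<forall>j. P (Inr j)" by (simp_all add: forall_2)
  then show "P i" by (cases i) auto
qed auto

lemma blocks_nth [simp]:
  "blocks A B C D $ Inl i $ Inl j = A $ i $ j" "blocks A B C D $ Inl i $ Inr j = B $ i $ j"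
  "blocks A B C D $ Inr i $ Inl j = C $ i $ j" "blocks A B C D $ Inr i $ Inr j = D $ i $ j"
  by (simp_all add: blocks_def)

lemma blocks_mult: "blocks A B C D ** blocks A' B' C' D' =
    blocks (A ** A' + B ** C') (A ** B' + B ** D') (C ** A' + D ** C') (C ** B' + D ** D')"
  by (simp add: vec_eq_iff forall_2_plus_2 matrix_matrix_mult_def sum_UNIV_Plus)

lemma transpose_blocks:
  "transpose (blocks A B C D) = blocks (transpose A) (transpose C) (transpose B) (transpose D)"
  by (simp add: vec_eq_iff forall_2_plus_2 transpose_def)

lemma mat_1_blocks: "mat 1 = blocks (mat 1) 0 0 (mat 1)"
  by (simp add: vec_eq_iff forall_2_plus_2 mat_def)

lemma uminus_blocks: "- blocks A B C D = blocks (- A) (- B) (- C) (- D)"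
  by (simp add: vec_eq_iff forall_2_plus_2)

text \<open>\<open>A\<close> acts on the symplectic plane of the coordinates \<open>Inl 1\<close>,
  \<open>Inr 1\<close>, and \<open>B\<close> on that of \<open>Inl 2\<close>, \<open>Inr 2\<close>.
  The block diagonal arrangement of \<open>SL2xSL2\<close> does not in general preserve
  \<open>symplectic_J\<close>.\<close>

definition emb :: "real^2^2 \<Rightarrow> real^2^2 \<Rightarrow> mat4" where
  "emb A B = blocks (m2 (A $ 1 $ 1) 0 0 (B $ 1 $ 1)) (m2 (A $ 1 $ 2) 0 0 (B $ 1 $ 2))
                    (m2 (A $ 2 $ 1) 0 0 (B $ 2 $ 1)) (m2 (A $ 2 $ 2) 0 0 (B $ 2 $ 2))"

lemma m2_add: "m2 a b c d + m2 a' b' c' d' = m2 (a + a') (b + b') (c + c') (d + d')"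
  by (simp add: vec_eq_iff forall_2)

lemma m2_uminus: "- m2 a b c d = m2 (- a) (- b) (- c) (- d)"
  by (simp add: vec_eq_iff forall_2)

lemma m2_zero: "0 = m2 0 0 0 0"
  by (simp add: vec_eq_iff forall_2)

lemma emb_mult: "emb A B ** emb A' B' = emb (A ** A') (B ** B')"
  by (simp add: emb_def blocks_mult m2_mult m2_add matrix_matrix_mult_def[of A] matrix_matrix_mult_def[of B] sum_2)

lemma emb_one: "emb (mat 1) (mat 1) = mat 1"
  by (simp add: emb_def mat_1_blocks mat_1_m2 m2_zero[symmetric])

lemma transpose_emb: "transpose (emb A B) = emb (transpose A) (transpose B)"
  by (simp add: emb_def transpose_blocks transpose_m2 transpose_def[of A] transpose_def[of B])

lemma norm_emb: "(norm (emb A B))\<^sup>2 = (norm A)\<^sup>2 + (norm B)\<^sup>2"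
  by (simp add: power2_norm_eq_inner inner_vec_def sum_UNIV_Plus sum_2 emb_def)

lemma norm_mat_1: "norm (mat 1 :: mat4) = 2"
proof -
  have "(norm (mat 1 :: mat4))\<^sup>2 = 2\<^sup>2"
    unfolding emb_one[symmetric] norm_emb by (simp add: mat_1_m2 norm_m2)
  then show ?thesis by (rule power2_eq_imp_eq) simp_all
qed

section \<open>The symplectic group and lower bounds in its quotient\<close>

abbreviation J where "J \<equiv> symplectic_J"

lemma J_J: "J ** J = - mat 1"
  by (simp add: symplectic_J_def blocks_mult mat_1_blocks uminus_blocks mat_1_m2 m2_uminus m2_zero m2_mult m2_add)

lemma transpose_J: "transpose J = - J"
  by (simp add: symplectic_J_def transpose_blocks mat_1_blocks uminus_blocks mat_1_m2 m2_uminus m2_zero transpose_m2)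

lemma matrix_mult_minus:
  fixes A :: "real^'n^'m" and B :: "real^'k^'n"
  shows "(- A) ** B = - (A ** B)" "A ** (- B) = - (A ** B)"
  by (simp_all add: bounded_bilinear.minus_left[OF bounded_bilinear_matrix_mult]
      bounded_bilinear.minus_right[OF bounded_bilinear_matrix_mult])

lemma orthogonal_J: "orthogonal_matrix J"
  by (simp add: orthogonal_matrix transpose_J matrix_mult_minus J_J)

lemma emb_Sp4:
  assumes "det A = 1" "det B = 1"
  shows "emb A B \<in> Sp4"
  using assms
  by (simp add: Sp4_def transpose_emb symplectic_J_def)
    (simp add: emb_def mat_1_m2 m2_uminus m2_zero blocks_mult m2_mult m2_add transpose_def det_2 algebra_simps)

lemma Sp4_left_inverse:
  assumes "g \<in> Sp4"
  shows "(- (J ** transpose g ** J)) ** g = mat 1"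
proof -
  have "(- (J ** transpose g ** J)) ** g = - (J ** (transpose g ** J ** g))"
    by (simp add: matrix_mult_minus matrix_mul_assoc)
  then show ?thesis using assms by (simp add: Sp4_def J_J)
qed

text \<open>The explicit inverse shows that inversion is continuous on \<open>Sp4\<close> and, as
  \<open>J\<close> is orthogonal, preserves the norm.\<close>

lemma matrix_inv_Sp4: "g \<in> Sp4 \<Longrightarrow> matrix_inv g = - (J ** transpose g ** J)"
  by (rule matrix_inv_eqI) (simp add: Sp4_left_inverse matrix_left_right_inverse[of g])

lemma Sp4_inverse:
  assumes "g \<in> Sp4"
  shows "matrix_inv g ** g = mat 1" "g ** matrix_inv g = mat 1"
  unfolding matrix_inv_Sp4[OF assms] matrix_left_right_inverse[of g]
  by (rule Sp4_left_inverse[OF assms])+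

lemma norm_matrix_inv_Sp4: "g \<in> Sp4 \<Longrightarrow> norm (matrix_inv g) = norm g"
  using orthogonal_J by (simp add: matrix_inv_Sp4 norm_orthogonal_mult norm_transpose)

lemma Sp4_one: "mat 1 \<in> Sp4"
  by (simp add: Sp4_def transpose_mat)

lemma Sp4_mult: "g \<in> Sp4 \<Longrightarrow> h \<in> Sp4 \<Longrightarrow> g ** h \<in> Sp4"
proof -
  assume *: "g \<in> Sp4" "h \<in> Sp4"
  have "transpose (g ** h) ** J ** (g ** h) = transpose h ** (transpose g ** J ** g) ** h"
    by (simp add: matrix_transpose_mul matrix_mul_assoc)
  then show "g ** h \<in> Sp4" using * by (simp add: Sp4_def)
qed

lemma Sp4_matrix_inv:
  assumes "g \<in> Sp4"
  shows "matrix_inv g \<in> Sp4"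
proof -
  let ?h = "matrix_inv g"
  have "transpose ?h ** J ** ?h = transpose ?h ** (transpose g ** J ** g) ** ?h"
    using assms by (simp add: Sp4_def)
  also have "\<dots> = transpose (g ** ?h) ** J ** (g ** ?h)"
    by (simp add: matrix_transpose_mul matrix_mul_assoc)
  finally show ?thesis by (simp add: Sp4_inverse(2)[OF assms] Sp4_def transpose_mat)
qed

lemma matrix_inv_mult_Sp4:
  assumes "g \<in> Sp4" "h \<in> Sp4"
  shows "matrix_inv (g ** h) = matrix_inv h ** matrix_inv g"
proof (rule matrix_inv_eqI)
  have "g ** h ** (matrix_inv h ** matrix_inv g) = g ** (h ** matrix_inv h) ** matrix_inv g"
    by (simp add: matrix_mul_assoc)
  then show "g ** h ** (matrix_inv h ** matrix_inv g) = mat 1"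
    using assms by (simp add: Sp4_inverse)
qed

lemma inner_transpose: "transpose (A::real^'n^'m) \<bullet> transpose B = A \<bullet> B"
  unfolding inner_vec_def transpose_def by simp (rule sum.swap)

text \<open>Elements of a coset differ by an orthogonal factor on the right, which the Frobenius
  norm ignores.\<close>

lemma left_coset_norm:
  fixes A :: mat4
  assumes "x \<in> left_coset g"
  shows "norm (A ** x) = norm (A ** g)"
  using assms by (auto simp: left_coset_def U2_def matrix_mul_assoc norm_orthogonal_mult)

text \<open>With \<open>m = h ** x\<close> and \<open>v = x ** X\<close> the derivative is the inner
  product of \<open>transpose m ** m\<close> with \<open>X\<close>, divided by the squared norm of
  \<open>m\<close>. The first matrix is symmetric, so only the symmetric part of \<open>X\<close>
  counts, whose norm is \<open>Sp4_norm x v\<close>.\<close>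

lemma Sp4_log_norm_derivative:
  assumes "x \<in> Sp4" "h \<in> Sp4"
  shows "\<exists>u'. ((\<lambda>x. ln (norm (h ** x))) has_derivative u') (at x) \<and> (\<forall>v. u' v \<le> Sp4_norm x v)"
proof -
  define m where "m = h ** x"
  have "m \<in> Sp4" using assms by (simp add: m_def Sp4_mult)
  have m0: "m \<noteq> 0"
  proof
    assume "m = 0"
    then have "mat 1 = (0::mat4)" using Sp4_inverse(1)[OF \<open>m \<in> Sp4\<close>]
      by (simp add: bounded_bilinear.zero_right[OF bounded_bilinear_matrix_mult])
    then show False using norm_mat_1 by simp
  qed
  have d1: "((\<lambda>x. h ** x) has_derivative (\<lambda>v. h ** v)) (at x)"
    by (rule bounded_linear_imp_has_derivative[OF bounded_linear_matrix_mult_right])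
  have d2: "((\<lambda>x. norm (h ** x)) has_derivative (\<lambda>v. (h ** v) \<bullet> sgn m)) (at x)"
    using has_derivative_compose[OF d1, of norm "\<lambda>v. v \<bullet> sgn m"] has_derivative_norm[OF m0]
    by (simp add: m_def)
  have "((\<lambda>x. ln (norm (h ** x))) has_derivative (\<lambda>v. (h ** v) \<bullet> sgn m / norm m)) (at x)"
    using has_derivative_ln[OF _ d2] m0 by (simp add: m_def[symmetric] divide_inverse mult.commute)
  moreover have "(h ** v) \<bullet> sgn m / norm m \<le> Sp4_norm x v" for v
  proof -
    define X where "X = matrix_inv x ** v"
    define P where "P = transpose m ** m"
    have hv: "h ** v = m ** X"
    proof -
      have "m ** X = h ** (x ** matrix_inv x) ** v" by (simp add: m_def X_def matrix_mul_assoc)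
      then show ?thesis using assms by (simp add: Sp4_inverse)
    qed
    have "P = transpose P" by (simp add: P_def matrix_transpose_mul)
    then have "P \<bullet> transpose X = P \<bullet> X" by (metis inner_transpose)
    then have "P \<bullet> X = P \<bullet> ((1 / 2) *\<^sub>R (X + transpose X))"
      by (simp add: inner_add_right)
    also have "\<dots> \<le> norm P * norm ((1 / 2) *\<^sub>R (X + transpose X))" by (rule norm_cauchy_schwarz)
    also have "\<dots> = norm P * Sp4_norm x v" by (simp add: Sp4_norm_def X_def Let_def)
    also have "\<dots> \<le> (norm m * norm m) * Sp4_norm x v"
      using norm_matrix_mult_le[of "transpose m" m]
      by (intro mult_right_mono) (auto simp: P_def norm_transpose Sp4_norm_def Let_def)
    finally have "(h ** v) \<bullet> m \<le> (norm m * norm m) * Sp4_norm x v"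
      by (simp add: hv P_def inner_matrix_mult_right[of m m X] inner_commute)
    then show ?thesis
      using m0 by (simp add: sgn_div_norm field_simps)
  qed
  ultimately show ?thesis by blast
qed

text \<open>The growth of \<open>ln (norm (matrix_inv g ** x))\<close> bounds the length of every
  curve between the cosets. It starts from the norm of the identity, which is 2, whence
  \<open>ln 2\<close>; \<open>c\<close> ensures that some curve exists.\<close>

lemma Sp4_mod_U2_dist_ge:
  assumes g: "g \<in> Sp4"
    and c: "c C1_differentiable_on UNIV" "range c \<subseteq> Sp4" "c 0 \<in> left_coset g" "c 1 \<in> left_coset h"
  shows "ln (norm (matrix_inv g ** h)) - ln 2 \<le> Sp4_mod_U2_dist (left_coset g) (left_coset h)"
proof -
  have cS: "c t \<in> Sp4" for t using c(2) by auto
  obtain u' where u': "\<And>x. x \<in> Sp4 \<Longrightarrow> ((\<lambda>x. ln (norm (matrix_inv g ** x))) has_derivative u' x) (at x)"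
    "\<And>x v. x \<in> Sp4 \<Longrightarrow> u' x v \<le> Sp4_norm x v"
    using Sp4_log_norm_derivative[OF _ Sp4_matrix_inv[OF g]] by metis
  have vd: "continuous_on UNIV (\<lambda>t. vector_derivative c (at t))"
    using c(1) by (simp add: C1_differentiable_on_eq)
  have cc: "continuous_on UNIV c"
    using c(1) by (simp add: C1_differentiable_on_eq differentiable_imp_continuous_within continuous_on_eq_continuous_within)
  have tr: "bounded_linear (transpose :: mat4 \<Rightarrow> mat4)"
    by (auto intro!: linear_conv_bounded_linear[THEN iffD1] linearI simp: transpose_def vec_eq_iff)
  \<comment> \<open>By the explicit inverse the speed of a C1 curve is continuous, hence
    integrable.\<close>
  have "continuous_on UNIV (\<lambda>t. Sp4_norm (c t) (vector_derivative c (at t)))"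
    unfolding Sp4_norm_def Let_def matrix_inv_Sp4[OF cS]
    by (intro continuous_intros bounded_bilinear.continuous_on[OF bounded_bilinear_matrix_mult]
        bounded_linear.continuous_on[OF tr] vd cc)
  then have int: "(\<lambda>t. Sp4_norm (c t) (vector_derivative c (at t))) integrable_on {0..1}"
    by (intro integrable_continuous_real) (rule continuous_on_subset, auto)
  show ?thesis
    unfolding Sp4_mod_U2_dist_def
  proof (rule riemannian_dist_ge[where F = Sp4_norm and c = c, OF _ _ _ _ int u'])
    show "valid_path c"
      using c(1) C1_differentiable_imp_piecewise C1_differentiable_on_subset unfolding valid_path_def by blast
    show "ln (norm (matrix_inv g ** h)) - ln 2 \<le> ln (norm (matrix_inv g ** y)) - ln (norm (matrix_inv g ** x))"
      if "x \<in> left_coset g" "y \<in> left_coset h" for x y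
      using left_coset_norm[OF that(1), of "matrix_inv g"] left_coset_norm[OF that(2), of "matrix_inv g"] g
      by (simp add: Sp4_inverse norm_mat_1)
  qed (use c in \<open>auto simp: path_image_def pathstart_def pathfinish_def\<close>)
qed

section \<open>Curves in the embedded subgroup\<close>

lemma emb_U2:
  assumes "orthogonal_matrix k" "det k = 1" "orthogonal_matrix k'" "det k' = 1"
  shows "emb k k' \<in> U2"
  using assms by (auto simp: U2_def emb_Sp4 orthogonal_matrix_def transpose_emb emb_mult emb_one)

text \<open>Both components of the displacement are decomposed as rotation, diagonal, rotation. The
  curve is a translate of the one-parameter group of the diagonal part; the rotations are absorbed
  into \<open>W\<close> and into the final coset.\<close>

lemma emb_curve:
  assumes A: "det A = 1" and B: "det B = 1" and A': "det A' = 1" and B': "det B' = 1"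
  obtains c L where "c C1_differentiable_on UNIV" "range c \<subseteq> Sp4" "c 0 \<in> left_coset (emb A B)"
    "c 1 \<in> left_coset (emb A' B')" "\<And>t. Sp4_norm (c t) (vector_derivative c (at t)) = L"
    "L \<le> ln ((norm (SL2_inv A ** A'))\<^sup>2) + ln ((norm (SL2_inv B ** B'))\<^sup>2)"
proof -
  have "det (SL2_inv A ** A') = 1" "det (SL2_inv B ** B') = 1"
    using assms by (simp_all add: det_mul SL2_inv)
  then obtain k1 r k1' k2 s k2' where
    k1: "orthogonal_matrix k1" "det k1 = 1" "orthogonal_matrix k1'" "det k1' = 1"
      "SL2_inv A ** A' = k1 ** m2 (exp r) 0 0 (exp (- r)) ** k1'" "2 * \<bar>r\<bar> \<le> ln ((norm (SL2_inv A ** A'))\<^sup>2)"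
    and k2: "orthogonal_matrix k2" "det k2 = 1" "orthogonal_matrix k2'" "det k2' = 1"
      "SL2_inv B ** B' = k2 ** m2 (exp s) 0 0 (exp (- s)) ** k2'" "2 * \<bar>s\<bar> \<le> ln ((norm (SL2_inv B ** B'))\<^sup>2)"
    using SL2_KAK by metis
  define a where "a r t = m2 (exp (r * t)) 0 0 (exp (- (r * t)))" for r t
  define W where "W = emb (A ** k1) (B ** k2)"
  \<comment> \<open>The generator of \<open>e\<close>. It is symmetric, so the speed of
    \<open>c\<close> is its full norm.\<close>
  define E where "E = emb (m2 r 0 0 (- r)) (m2 s 0 0 (- s))"
  define e where "e t = emb (a r t) (a s t)" for t
  define c where "c t = W ** e t" for t
  have W: "W \<in> Sp4" unfolding W_def using assms k1 k2 by (intro emb_Sp4) (simp_all add: det_mul)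
  have da: "det (a r t) = 1" for r t by (simp add: a_def det_m2 flip: exp_add)
  have e: "e t \<in> Sp4" for t unfolding e_def by (intro emb_Sp4 da)
  have "(e has_vector_derivative e t ** E) (at t)" for t
  proof (rule has_vector_derivative_matrixI)
    have "\<forall>i j. ((\<lambda>t. e t $ i $ j) has_real_derivative (e t ** E) $ i $ j) (at t)"
      unfolding forall_2_plus_2 e_def E_def emb_mult a_def m2_mult
      by (auto simp: emb_def intro!: derivative_eq_intros)
    then show "((\<lambda>t. e t $ i $ j) has_real_derivative (e t ** E) $ i $ j) (at t)" for i j by blast
  qed
  then have c': "(c has_vector_derivative c t ** E) (at t)" for t
    unfolding c_def matrix_mul_assoc[symmetric]
    by (rule bounded_linear.has_vector_derivative[OF bounded_linear_matrix_mult_right])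
  then have "continuous_on UNIV c"
    by (meson continuous_at_imp_continuous_on has_vector_derivative_continuous)
  then have "continuous_on UNIV (\<lambda>t. c t ** E)"
    by (rule bounded_linear.continuous_on[OF bounded_linear_matrix_mult_left])
  then have 1: "c C1_differentiable_on UNIV"
    unfolding C1_differentiable_on_def using c' by (intro exI[of _ "\<lambda>t. c t ** E"]) simp
  have cS: "c t \<in> Sp4" for t by (simp add: c_def W e Sp4_mult)
  then have 2: "range c \<subseteq> Sp4" by blast
  have "e 0 = mat 1" by (simp add: e_def a_def mat_1_m2[symmetric] emb_one)
  then have "c 0 = emb A B ** emb k1 k2" by (simp add: c_def W_def emb_mult)
  then have 3: "c 0 \<in> left_coset (emb A B)"
    using k1 k2 emb_U2 by (auto simp: left_coset_def)
  \<comment> \<open>The right-hand rotations form an element of \<open>U2\<close>, so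
    \<open>c 1\<close> and \<open>emb A' B'\<close> lie in the same coset.\<close>
  have "c 1 ** emb k1' k2' = emb (A ** (SL2_inv A ** A')) (B ** (SL2_inv B ** B'))"
    by (simp add: c_def e_def W_def emb_mult k1(5) k2(5) a_def matrix_mul_assoc)
  also have "\<dots> = emb A' B'" using A B by (simp add: matrix_mul_assoc SL2_inv)
  finally have "c 1 ** emb k1' k2' = emb A' B'" .
  then have "emb A' B' ** transpose (emb k1' k2') = c 1 ** (emb k1' k2' ** transpose (emb k1' k2'))"
    by (metis matrix_mul_assoc)
  then have "c 1 = emb A' B' ** emb (transpose k1') (transpose k2')"
    using emb_U2[OF k1(3,4) k2(3,4)] by (simp add: U2_def orthogonal_matrix_def transpose_emb)
  then have 4: "c 1 \<in> left_coset (emb A' B')"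
    using emb_U2[of "transpose k1'" "transpose k2'"] k1 k2
    by (auto simp: left_coset_def orthogonal_matrix_transpose det_transpose)
  have 5: "Sp4_norm (c t) (vector_derivative c (at t)) = norm E" for t
  proof -
    have "matrix_inv (c t) ** (c t ** E) = E"
      by (simp add: matrix_mul_assoc Sp4_inverse cS)
    moreover have "transpose E = E" by (simp add: E_def transpose_emb transpose_m2)
    ultimately show ?thesis
      unfolding vector_derivative_at[OF c'] by (simp add: Sp4_norm_def Let_def scaleR_2[symmetric])
  qed
  have "(norm E)\<^sup>2 = 2 * r\<^sup>2 + 2 * s\<^sup>2" by (simp add: E_def norm_emb norm_m2)
  also have "\<dots> \<le> (2 * \<bar>r\<bar> + 2 * \<bar>s\<bar>)\<^sup>2"
  proof -
    have "(2 * \<bar>r\<bar> + 2 * \<bar>s\<bar>)\<^sup>2 = 4 * r\<^sup>2 + 4 * s\<^sup>2 + 8 * (\<bar>r\<bar> * \<bar>s\<bar>)"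
      by (simp add: power2_sum power_mult_distrib)
    moreover have "0 \<le> \<bar>r\<bar> * \<bar>s\<bar>" "0 \<le> r\<^sup>2" "0 \<le> s\<^sup>2" by simp_all
    ultimately show ?thesis by linarith
  qed
  finally have "norm E \<le> 2 * \<bar>r\<bar> + 2 * \<bar>s\<bar>" by (rule power2_le_imp_le) simp
  then show ?thesis using that[OF 1 2 3 4 5] k1(6) k2(6) by linarith
qed

section \<open>The stretched embedding\<close>

definition stretch :: "complex \<Rightarrow> complex" where
  "stretch z = of_real (cmod z) * z"

text \<open>Lifts the map \<open>f\<close> to the group, so that the norm of
  \<open>matrix_inv (stretch_lift p) ** stretch_lift q\<close> can stand in for distance.\<close>

definition stretch_lift :: "complex \<times> complex \<Rightarrow> mat4" where
  "stretch_lift p = emb (to_SL2 (stretch (fst p))) (to_SL2 (snd p))"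

lemma stretch_H2: "z \<in> H2 \<Longrightarrow> stretch z \<in> H2"
  by (auto simp: stretch_def H2_def zero_less_mult_iff)

lemma stretch_lift_Sp4: "p \<in> H2 \<times> H2 \<Longrightarrow> stretch_lift p \<in> Sp4"
  by (auto simp: stretch_lift_def intro!: emb_Sp4 det_to_SL2 stretch_H2)

lemma norm_stretch_lift:
  assumes "p \<in> H2 \<times> H2" "q \<in> H2 \<times> H2"
  shows "(norm (matrix_inv (stretch_lift p) ** stretch_lift q))\<^sup>2 = Q (stretch (fst p)) (stretch (fst q)) + Q (snd p) (snd q)"
proof -
  have H: "stretch (fst p) \<in> H2" "stretch (fst q) \<in> H2" "snd p \<in> H2" "snd q \<in> H2"
    using assms by (auto intro: stretch_H2)
  have "matrix_inv (stretch_lift p) = emb (SL2_inv (to_SL2 (stretch (fst p)))) (SL2_inv (to_SL2 (snd p)))"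
    using H by (intro matrix_inv_eqI) (simp add: stretch_lift_def emb_mult SL2_inv det_to_SL2 emb_one)
  then show ?thesis
    using H by (simp add: stretch_lift_def emb_mult norm_emb norm_to_SL2)
qed

lemma Q_cmod: "Q z w = ((cmod z)\<^sup>2 + (cmod w)\<^sup>2 - 2 * (Re z * Re w)) / (Im z * Im w)"
  unfolding Q_def cmod_power2 by (simp add: power2_eq_square algebra_simps)

text \<open>Stretching multiplies real and imaginary parts by the modulus, so everything is
  expressed in the moduli \<open>r\<close> and \<open>\<rho>\<close>. The first and last bounds
  control \<open>ln Q\<close> up to a factor 2 and a constant, which gives the quasi-isometry; the
  middle one serves points of nearly equal modulus.\<close>

lemma Q_stretch:
  assumes "z \<in> H2" "w \<in> H2"
  shows "Q z w \<le> Q (stretch z) (stretch w)"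
    and "Q (stretch z) (stretch w) \<le> ((cmod z - cmod w)\<^sup>2 / (cmod z * cmod w) + 4) * Q z w"
    and "Q (stretch z) (stretch w) \<le> 3 * (Q z w)\<^sup>2"
proof -
  define r \<rho> P \<sigma> where "r = cmod z" "\<rho> = cmod w" "P = Re z * Re w" "\<sigma> = Im z * Im w"
  note defs = r_\<rho>_P_\<sigma>_def
  have pos: "r > 0" "\<rho> > 0" "\<sigma> > 0"
    using assms by (auto simp: defs H2_def)
  have "\<bar>Re z\<bar> * \<bar>Re w\<bar> \<le> r * \<rho>" "\<bar>Im z\<bar> * \<bar>Im w\<bar> \<le> r * \<rho>"
    unfolding defs by (intro mult_mono abs_Re_le_cmod abs_Im_le_cmod; simp)+
  then have P: "P \<le> r * \<rho>" "\<sigma> \<le> r * \<rho>"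
    unfolding defs abs_mult[symmetric] by linarith+
  have Q: "Q z w = (r\<^sup>2 + \<rho>\<^sup>2 - 2 * P) / \<sigma>" by (simp add: Q_cmod defs)
  have Q': "Q (stretch z) (stretch w) = (r^4 + \<rho>^4 - 2 * (r * \<rho> * P)) / (r * \<rho> * \<sigma>)"
    unfolding Q_cmod by (simp add: stretch_def norm_mult defs power2_eq_square power4_eq_xxxx mult_ac)
  \<comment> \<open>The difference is \<open>(r - \<rho>) * (r^3 - \<rho>^3)\<close>, whose factors
    have equal sign.\<close>
  have "(r * \<rho>) * (r\<^sup>2 + \<rho>\<^sup>2) \<le> r^4 + \<rho>^4"
  proof -
    have "r^4 + \<rho>^4 - (r * \<rho>) * (r\<^sup>2 + \<rho>\<^sup>2) = (r - \<rho>)\<^sup>2 * (r\<^sup>2 + r * \<rho> + \<rho>\<^sup>2)"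
      by (simp add: power2_eq_square power4_eq_xxxx algebra_simps)
    also have "\<dots> \<ge> 0" using pos by (intro mult_nonneg_nonneg) auto
    finally show ?thesis by simp
  qed
  then have "(r * \<rho>) * (r\<^sup>2 + \<rho>\<^sup>2 - 2 * P) / (r * \<rho> * \<sigma>) \<le> Q (stretch z) (stretch w)"
    unfolding Q' using pos by (intro divide_right_mono) (auto simp: algebra_simps)
  then show "Q z w \<le> Q (stretch z) (stretch w)" unfolding Q using pos by simp
  \<comment> \<open>The resulting factor \<open>(r + \<rho>)\<^sup>2 / (r * \<rho>)\<close> is 4
    when the moduli agree.\<close>
  have "r^4 + \<rho>^4 - 2 * (r * \<rho> * P) \<le> (r + \<rho>)\<^sup>2 * (r\<^sup>2 + \<rho>\<^sup>2 - 2 * P)"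
  proof -
    have "(r + \<rho>)\<^sup>2 * (r\<^sup>2 + \<rho>\<^sup>2 - 2 * P) - (r^4 + \<rho>^4 - 2 * (r * \<rho> * P)) =
        2 * (r * \<rho> + r\<^sup>2 + \<rho>\<^sup>2) * (r * \<rho> - P)"
      by (simp add: power2_eq_square power4_eq_xxxx algebra_simps)
    also have "\<dots> \<ge> 0" using pos P by (intro mult_nonneg_nonneg) auto
    finally show ?thesis by simp
  qed
  then have "Q (stretch z) (stretch w) \<le> (r + \<rho>)\<^sup>2 * (r\<^sup>2 + \<rho>\<^sup>2 - 2 * P) / (r * \<rho> * \<sigma>)"
    unfolding Q' using pos by (intro divide_right_mono) auto
  also have "\<dots> = (r + \<rho>)\<^sup>2 / (r * \<rho>) * Q z w" unfolding Q by simp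
  also have "(r + \<rho>)\<^sup>2 / (r * \<rho>) = (r - \<rho>)\<^sup>2 / (r * \<rho>) + 4"
    using pos by (simp add: field_simps power2_eq_square)
  finally have le: "Q (stretch z) (stretch w) \<le> ((r - \<rho>)\<^sup>2 / (r * \<rho>) + 4) * Q z w" .
  then show "Q (stretch z) (stretch w) \<le> ((cmod z - cmod w)\<^sup>2 / (cmod z * cmod w) + 4) * Q z w"
    by (simp add: defs)
  \<comment> \<open>Hyperbolically close points have comparable moduli: \<open>Q z w\<close> bounds
    \<open>(r - \<rho>)\<^sup>2 / (r * \<rho>)\<close>. With \<open>Q z w \<ge> 2\<close> the whole
    factor is at most \<open>3 * Q z w\<close>.\<close>
  have "(r - \<rho>)\<^sup>2 \<le> Q z w * \<sigma>"
  proof -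
    have "Q z w * \<sigma> = r\<^sup>2 + \<rho>\<^sup>2 - 2 * P" unfolding Q using pos by simp
    then show ?thesis using P(1) by (simp add: power2_diff)
  qed
  also have "\<dots> \<le> Q z w * (r * \<rho>)"
    using P Q_ge_2[OF assms] by (intro mult_left_mono) auto
  finally have "(r - \<rho>)\<^sup>2 / (r * \<rho>) \<le> Q z w" using pos by (simp add: field_simps)
  then have "(r - \<rho>)\<^sup>2 / (r * \<rho>) + 4 \<le> 3 * Q z w" using Q_ge_2[OF assms] by linarith
  then have "((r - \<rho>)\<^sup>2 / (r * \<rho>) + 4) * Q z w \<le> (3 * Q z w) * Q z w"
    using Q_ge_2[OF assms] by (intro mult_right_mono) auto
  then show "Q (stretch z) (stretch w) \<le> 3 * (Q z w)\<^sup>2" using le by (simp add: power2_eq_square)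
qed

text \<open>Both distances are compared with sums of values of \<open>ln Q\<close>. The factor 8 is
  2 times 4: up to constants, stretching at most doubles \<open>ln Q\<close>, and the source
  distance is at least a quarter of the sum. The additive 8 is generous.\<close>

lemma quasi_isometric_embedding_stretch_lift:
  "quasi_isometric_embedding (H2 \<times> H2) H2xH2_dist Sp4_mod_U2 Sp4_mod_U2_dist (\<lambda>p. left_coset (stretch_lift p))"
  unfolding quasi_isometric_embedding_def
proof (intro conjI exI[of _ "8::real"] exI[of _ "8::real"] ballI)
  show "(\<lambda>p. left_coset (stretch_lift p)) ` (H2 \<times> H2) \<subseteq> Sp4_mod_U2"
    using stretch_lift_Sp4 by (auto simp: Sp4_mod_U2_def)
next
  fix p q :: "complex \<times> complex" assume pq: "p \<in> H2 \<times> H2" "q \<in> H2 \<times> H2"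
  let ?d = "H2xH2_dist p q" and ?D = "Sp4_mod_U2_dist (left_coset (stretch_lift p)) (left_coset (stretch_lift q))"
  define a b b' where "a = Q (snd p) (snd q)" "b = Q (fst p) (fst q)" "b' = Q (stretch (fst p)) (stretch (fst q))"
  note defs = a_b_b'_def
  have H: "fst p \<in> H2" "snd p \<in> H2" "fst q \<in> H2" "snd q \<in> H2" using pq by auto
  have ge: "a \<ge> 2" "b \<ge> 2" "b' \<ge> 2" "b \<le> b'" "b' \<le> 3 * b\<^sup>2"
    using H by (auto simp: defs intro!: Q_ge_2 Q_stretch stretch_H2)
  have ln2: "0 < ln (2::real)" "ln (2::real) \<le> 1" "ln (3::real) \<le> 2"
    using ln_le_minus_one[of 2] ln_le_minus_one[of 3] by auto
  have d: "?d \<le> ln b + ln a" "(ln b + ln a) / 4 - ln 2 / 2 \<le> ?d"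
    using H2xH2_dist_bounds[OF pq] by (simp_all add: defs)
  obtain c L where c: "c C1_differentiable_on UNIV" "range c \<subseteq> Sp4" "c 0 \<in> left_coset (stretch_lift p)"
    "c 1 \<in> left_coset (stretch_lift q)" "\<And>t. Sp4_norm (c t) (vector_derivative c (at t)) = L" "L \<le> ln b' + ln a"
    using emb_curve[of "to_SL2 (stretch (fst p))" "to_SL2 (snd p)" "to_SL2 (stretch (fst q))" "to_SL2 (snd q)"] H
    by (auto simp: det_to_SL2 stretch_H2 norm_to_SL2 stretch_lift_def defs)
  have "?D \<le> L"
    unfolding Sp4_mod_U2_dist_def
    by (rule riemannian_dist_le[where F = Sp4_norm, OF c(1-5)]) (simp add: Sp4_norm_def Let_def)
  then have D1: "?D \<le> ln b' + ln a" using c(6) by linarith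
  define n where "n = norm (matrix_inv (stretch_lift p) ** stretch_lift q)"
  have n2: "n\<^sup>2 = b' + a" using norm_stretch_lift[OF pq] by (simp add: n_def defs)
  then have "n \<noteq> 0" using ge by auto
  then have n: "n > 0" by (simp add: n_def)
  \<comment> \<open>The logarithm of the sum dominates both logarithms, hence their mean.\<close>
  have "2 * ln n = ln (b' + a)" using n by (simp add: ln_realpow flip: n2)
  moreover have "ln b' \<le> ln (b' + a)" "ln a \<le> ln (b' + a)" using ge by simp_all
  ultimately have "(ln b' + ln a) / 4 \<le> ln n"
    by argo
  also have "ln n - ln 2 \<le> ?D"
    unfolding n_def by (rule Sp4_mod_U2_dist_ge[OF stretch_lift_Sp4[OF pq(1)] c(1-4)])
  then have "ln n \<le> ?D + ln 2" by linarith
  finally have D2: "(ln b' + ln a) / 4 - ln 2 \<le> ?D" by linarith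
  have "ln b \<le> ln b'" using ge by simp
  moreover have "ln b' \<le> ln (3 * b\<^sup>2)" using ge by (subst ln_le_cancel_iff) auto
  then have "ln b' \<le> ln 3 + 2 * ln b" using ge by (simp add: ln_mult ln_realpow)
  moreover have "ln a \<ge> 0" "ln b \<ge> 0" using ge by simp_all
  ultimately show "(1 / 8) * ?d - 8 \<le> ?D" "?D \<le> 8 * ?d + 8"
    using d D1 D2 ln2 by argo+
qed auto

section \<open>Comparison with \<open>AN\<close>-maps\<close>

lemma blocks_diag_mult: "blocks A 0 0 B ** blocks A' 0 0 B' = blocks (A ** A') 0 0 (B ** B')"
  by (simp add: blocks_mult)

lemma block11_blocks [simp]: "block11 (blocks A B C D) = A"
  and block22_blocks [simp]: "block22 (blocks A B C D) = D"
  by (simp_all add: block11_def block22_def vec_eq_iff)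

lemma SL2xSL2_act_blocks:
  "SL2xSL2_act (blocks A 0 0 B) p = (SL2_act A (fst p), SL2_act B (snd p))"
  by (simp add: SL2xSL2_act_def)

lemma SL2xSL2_act_mult:
  assumes "M \<in> SL2xSL2" "N \<in> SL2xSL2" "p \<in> H2 \<times> H2"
  shows "SL2xSL2_act (M ** N) p = SL2xSL2_act M (SL2xSL2_act N p)"
  using assms by (auto simp: SL2xSL2_def blocks_mult SL2xSL2_act_blocks SL2_act_mult)

lemma SL2xSL2_act_in:
  assumes "M \<in> SL2xSL2" "p \<in> H2 \<times> H2"
  shows "SL2xSL2_act M p \<in> H2 \<times> H2"
  using assms by (auto simp: SL2xSL2_def SL2xSL2_act_blocks SL2_act_H2)

lemma SL2xSL2_act_Q:
  assumes "M \<in> SL2xSL2" "p \<in> H2 \<times> H2" "q \<in> H2 \<times> H2"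
  shows "Q (fst (SL2xSL2_act M p)) (fst (SL2xSL2_act M q)) = Q (fst p) (fst q)"
    and "Q (snd (SL2xSL2_act M p)) (snd (SL2xSL2_act M q)) = Q (snd p) (snd q)"
  using assms by (auto simp: SL2xSL2_def SL2xSL2_act_blocks Q_SL2_act)

lemma SL2xSL2_act_one: "SL2xSL2_act (mat 1) p = p"
  by (simp add: mat_1_blocks SL2xSL2_act_blocks SL2_act_one)

lemma SL2xSL2_mult: "M \<in> SL2xSL2 \<Longrightarrow> N \<in> SL2xSL2 \<Longrightarrow> M ** N \<in> SL2xSL2"
  by (force simp: SL2xSL2_def blocks_diag_mult det_mul)

lemma SL2xSL2_inverse:
  assumes "M \<in> SL2xSL2"
  obtains M' where "M' \<in> SL2xSL2" "M' ** M = mat 1" "M ** M' = mat 1"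
proof -
  obtain A B where M: "M = blocks A 0 0 B" and det: "det A = 1" "det B = 1"
    using assms by (auto simp: SL2xSL2_def)
  define M' where "M' = blocks (SL2_inv A) 0 0 (SL2_inv B)"
  have "M' \<in> SL2xSL2"
    unfolding SL2xSL2_def M'_def using SL2_inv(3) det by blast
  moreover have "M' ** M = mat 1" "M ** M' = mat 1"
    unfolding M M'_def blocks_diag_mult mat_1_blocks by (simp_all add: SL2_inv det)
  ultimately show ?thesis by (rule that)
qed

lemma SL2xSL2_transitive:
  assumes "p \<in> H2 \<times> H2" "q \<in> H2 \<times> H2"
  obtains M where "M \<in> SL2xSL2" "SL2xSL2_act M p = q"
proof -
  have ex: "\<exists>A. det A = 1 \<and> SL2_act A z = w" if zw: "z \<in> H2" "w \<in> H2" for z w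
  proof (intro exI conjI)
    let ?A = "to_SL2 z" and ?B = "to_SL2 w"
    have i: "\<i> \<in> H2" by (simp add: H2_def)
    show "det (?B ** SL2_inv ?A) = 1" using zw by (simp add: det_mul SL2_inv det_to_SL2)
    have "SL2_act (?B ** SL2_inv ?A) z = SL2_act (?B ** SL2_inv ?A ** ?A) \<i>"
      using zw i by (simp add: SL2_act_mult[of ?A] det_to_SL2 SL2_act_to_SL2)
    then show "SL2_act (?B ** SL2_inv ?A) z = w"
      using zw by (simp add: matrix_mul_assoc[symmetric] SL2_inv det_to_SL2 SL2_act_to_SL2)
  qed
  obtain A B where "det A = 1" "SL2_act A (fst p) = fst q" "det B = 1" "SL2_act B (snd p) = snd q"
    using ex[of "fst p" "fst q"] ex[of "snd p" "snd q"] assms by auto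
  then show ?thesis
    by (intro that[of "blocks A 0 0 B"]) (auto simp: SL2xSL2_def SL2xSL2_act_blocks)
qed

text \<open>Some \<open>M\<close> carries \<open>p\<close> to \<open>o1\<close>. In
  \<open>M = k ** s\<close> the factor \<open>k\<close> fixes \<open>o1\<close>, so \<open>s\<close>
  alone carries \<open>p\<close> to \<open>o1\<close>, and its inverse carries \<open>o1\<close> to
  \<open>p\<close>.\<close>

lemma AN_transitive:
  assumes iw: "iwasawa_decomposition SL2xSL2 K A N" and o1: "o1 \<in> H2 \<times> H2"
    and fix_o1: "\<And>k. k \<in> K \<Longrightarrow> SL2xSL2_act k o1 = o1" and p: "p \<in> H2 \<times> H2"
  obtains s where "s \<in> set_mult A N" "SL2xSL2_act s o1 = p"
proof -
  obtain M where M: "M \<in> SL2xSL2" "SL2xSL2_act M p = o1"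
    using SL2xSL2_transitive[OF p o1] .
  obtain k s where ks: "k \<in> K" "s \<in> set_mult A N" "M = k ** s"
    using iwasawa_factor[OF iw M(1)] .
  have G: "k \<in> SL2xSL2" "s \<in> SL2xSL2" using ks iwasawa_subset[OF iw] by auto
  obtain s' where s': "s' \<in> set_mult A N" "s ** s' = mat 1" "s' ** s = mat 1"
    using AN_inverse[OF iw ks(2)] .
  have sG': "s' \<in> SL2xSL2" using s' iwasawa_subset[OF iw] by auto
  obtain k' where k': "k' \<in> SL2xSL2" "k' ** k = mat 1" using SL2xSL2_inverse[OF G(1)] by metis
  have sp: "SL2xSL2_act s p \<in> H2 \<times> H2" by (rule SL2xSL2_act_in[OF G(2) p])
  have "SL2xSL2_act k (SL2xSL2_act s p) = SL2xSL2_act k o1"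
    using M(2) fix_o1[OF ks(1)] by (simp add: ks(3) SL2xSL2_act_mult[OF G p])
  then have "SL2xSL2_act (k' ** k) (SL2xSL2_act s p) = SL2xSL2_act (k' ** k) o1"
    by (simp add: SL2xSL2_act_mult[OF k'(1) G(1)] sp o1)
  then have "SL2xSL2_act s p = o1" by (simp add: k'(2) SL2xSL2_act_one)
  then have "SL2xSL2_act s' o1 = SL2xSL2_act (s' ** s) p"
    by (simp add: SL2xSL2_act_mult[OF sG' G(2) p])
  then show ?thesis using that s' by (simp add: SL2xSL2_act_one)
qed

section \<open>Norms as a substitute for distances in the target\<close>

lemma Sp4_act_left_coset: "Sp4_act g (left_coset h) = left_coset (g ** h)"
  by (auto simp: Sp4_act_def left_coset_def image_iff simp flip: matrix_mul_assoc)

lemma mem_left_coset: "g \<in> left_coset g"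
proof -
  have "mat 1 \<in> U2" by (simp add: U2_def Sp4_one orthogonal_matrix_id)
  then show ?thesis by (force simp: left_coset_def)
qed

text \<open>Turns a distance bound into a multiplicative one. The curve that the lower bound
  requires is a path in \<open>Sp4\<close> from the identity to \<open>matrix_inv g ** h\<close>,
  translated by \<open>g\<close>.\<close>

lemma norm_le_of_dist:
  assumes iw: "iwasawa_decomposition Sp4 K A N" and gh: "g \<in> Sp4" "h \<in> Sp4"
    and le: "Sp4_mod_U2_dist (left_coset g) (left_coset h) \<le> B"
  shows "norm (matrix_inv g ** h) \<le> 2 * exp B"
proof -
  obtain c where c: "mcurve Sp4 c" "c 1 = matrix_inv g ** h"
    using iwasawa_mcurve[OF iw _ Sp4_one Sp4_mult, of "matrix_inv g ** h"] gh Sp4_mult Sp4_matrix_inv by blast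
  have "ln (norm (matrix_inv g ** h)) - ln 2 \<le> Sp4_mod_U2_dist (left_coset g) (left_coset h)"
  proof (rule Sp4_mod_U2_dist_ge[OF gh(1), where c = "\<lambda>t. g ** c t"])
    show "(\<lambda>t. g ** c t) C1_differentiable_on UNIV"
      using c(1) by (intro C1_differentiable_on_matrix_mult) (simp_all add: mcurve_def)
    show "range (\<lambda>t. g ** c t) \<subseteq> Sp4" using c(1) gh(1) by (auto simp: mcurve_def intro!: Sp4_mult)
    show "g ** c 0 \<in> left_coset g" using c(1) by (simp add: mcurve_def mem_left_coset)
    show "g ** c 1 \<in> left_coset h" using gh by (simp add: c(2) matrix_mul_assoc Sp4_inverse mem_left_coset)
  qed
  then have *: "ln (norm (matrix_inv g ** h)) \<le> ln (2 * exp B)" using le by (simp add: ln_mult)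
  show ?thesis
  proof (cases "norm (matrix_inv g ** h) = 0")
    case False
    then have "norm (matrix_inv g ** h) > 0" by simp
    then show ?thesis using * by (subst (asm) ln_le_cancel_iff) auto
  qed simp
qed

lemma norm_matrix_inv_mult_triangle:
  assumes "g \<in> Sp4" "h \<in> Sp4" "k \<in> Sp4"
  shows "norm (matrix_inv g ** k) \<le> norm (matrix_inv g ** h) * norm (matrix_inv h ** k)"
proof -
  have "matrix_inv g ** k = matrix_inv g ** (h ** matrix_inv h) ** k"
    using assms by (simp add: Sp4_inverse)
  also have "\<dots> = (matrix_inv g ** h) ** (matrix_inv h ** k)" by (simp add: matrix_mul_assoc)
  finally show ?thesis by (simp add: norm_matrix_mult_le)
qed

text \<open>The two products are inverse to each other, and inversion preserves the norm on
  \<open>Sp4\<close>.\<close>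

lemma norm_matrix_inv_mult_commute:
  assumes "g \<in> Sp4" "h \<in> Sp4"
  shows "norm (matrix_inv g ** h) = norm (matrix_inv h ** g)"
proof -
  have "matrix_inv (matrix_inv g ** h) = matrix_inv h ** g"
    using assms matrix_inv_eqI[OF Sp4_inverse(1)[OF assms(1)]]
    by (simp add: matrix_inv_mult_Sp4 Sp4_matrix_inv)
  then show ?thesis
    using norm_matrix_inv_Sp4[of "matrix_inv g ** h"] assms by (simp add: Sp4_mult Sp4_matrix_inv)
qed

text \<open>
  Hyperbolic balls of a fixed radius near the boundary point \<open>1\<close> are small in the Euclidean
  metric, and \<open>stretch\<close> is there a coarse isometry.
\<close>

lemma Q_stretch_deep:
  assumes "e > 0" "16 * q * e \<le> 1" "w \<in> H2" "Q (1 + of_real e * \<i>) w = q"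
  shows "Q (stretch (1 + of_real e * \<i>)) (stretch w) \<le> 5 * q"
proof -
  define z where "z = 1 + of_real e * \<i>"
  have z: "Im z = e" "z \<in> H2" using assms(1) by (simp_all add: z_def H2_def)
  have q: "q \<ge> 2" using Q_ge_2[OF z(2) assms(3)] assms(4) by (simp add: z_def)
  have "e * 32 \<le> 16 * q * e" using q assms(1) by simp
  then have e: "e \<le> 1 / 32" using assms(2) by linarith
  define d where "d = cmod (z - w)"
  have d0: "d \<ge> 0" by (simp add: d_def)
  have w: "0 < Im w" using assms(3) by (simp add: H2_def)
  have "Im w \<le> e + d"
    using abs_Im_le_cmod[of "z - w"] by (simp add: d_def z)
  have "d\<^sup>2 / (e * Im w) + 2 = q"
    using assms(4) Q_alt[OF z(2) assms(3)] by (simp add: z_def[symmetric] d_def z)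
  then have "d\<^sup>2 = (q - 2) * (e * Im w)"
    using assms(1) w by (auto simp: field_simps)
  also have "\<dots> \<le> q * (e * (e + d))"
    using q assms(1) w \<open>Im w \<le> e + d\<close> by (intro mult_mono) auto
  finally have d2: "d\<^sup>2 \<le> q * e * (e + d)" by (simp add: mult_ac)
  \<comment> \<open>As \<open>q * e \<le> 1 / 16\<close>, the quadratic inequality \<open>d2\<close>
    forces the Euclidean distance to be small.\<close>
  have d: "d \<le> 1 / 4"
  proof (rule ccontr)
    assume "\<not> d \<le> 1 / 4"
    then have d4: "d > 1 / 4" by simp
    have "q * e * (e + d) \<le> (1 / 16) * (e + d)"
      using assms(1,2) d0 by (intro mult_right_mono) auto
    also have "\<dots> \<le> (1 / 16) * (2 * d)" using d4 e by simp
    finally have "d * d \<le> (1 / 8) * d" using d2 by (simp add: power2_eq_square)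
    then show False using d4 by simp
  qed
  \<comment> \<open>Both moduli are bounded below and differ little, so the factor in the middle
    bound of \<open>Q_stretch\<close> is at most \<open>1 + 4\<close>.\<close>
  have r1: "cmod z \<ge> 1" using complex_Re_le_cmod[of z] by (simp add: z_def)
  have rd: "\<bar>cmod z - cmod w\<bar> \<le> 1 / 4"
    using norm_triangle_ineq3[of z w] d by (simp add: d_def)
  then have rw: "cmod w \<ge> 3 / 4" using r1 by linarith
  have "1 * (3 / 4) \<le> cmod z * cmod w" using r1 rw by (intro mult_mono) auto
  moreover have "(cmod z - cmod w)\<^sup>2 \<le> (1 / 4)\<^sup>2"
    using rd by (metis abs_ge_zero power2_abs power_mono)
  ultimately have "(cmod z - cmod w)\<^sup>2 / (cmod z * cmod w) \<le> 1"
    by (subst divide_le_eq_1_pos) (auto simp: power2_eq_square)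
  then have "((cmod z - cmod w)\<^sup>2 / (cmod z * cmod w) + 4) * Q z w \<le> 5 * Q z w"
    using Q_ge_2[OF z(2) assms(3)] by (intro mult_right_mono) auto
  then show ?thesis
    using Q_stretch(2)[OF z(2) assms(3)] assms(4) by (simp add: z_def)
qed

lemma AN_map_unbounded:
  assumes AN: "AN_map SL2xSL2 (H2 \<times> H2) SL2xSL2_act Sp4 Sp4_mod_U2 Sp4_act g"
  shows "\<not> at_bounded_distance (H2 \<times> H2) Sp4_mod_U2_dist (\<lambda>p. left_coset (stretch_lift p)) g"
proof
  assume "at_bounded_distance (H2 \<times> H2) Sp4_mod_U2_dist (\<lambda>p. left_coset (stretch_lift p)) g"
  then obtain B where B: "\<And>p. p \<in> H2 \<times> H2 \<Longrightarrow> Sp4_mod_U2_dist (left_coset (stretch_lift p)) (g p) \<le> B"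
    unfolding at_bounded_distance_def bdd_above_def by auto
  obtain K1 A1 N1 K2 A2 N2 o1 o2 \<phi> where iw1: "iwasawa_decomposition SL2xSL2 K1 A1 N1"
    and iw2: "iwasawa_decomposition Sp4 K2 A2 N2"
    and o1: "o1 \<in> H2 \<times> H2" "\<And>k. k \<in> K1 \<Longrightarrow> SL2xSL2_act k o1 = o1"
    and o2: "o2 \<in> Sp4_mod_U2" and hom: "lie_group_hom (set_mult A1 N1) (set_mult A2 N2) \<phi>"
    and g: "\<And>s. s \<in> set_mult A1 N1 \<Longrightarrow> g (SL2xSL2_act s o1) = Sp4_act (\<phi> s) o2"
    using AN unfolding AN_map_def by blast
  define S where "S = set_mult A1 N1"
  obtain h where h: "h \<in> Sp4" "o2 = left_coset h" using o2 by (auto simp: Sp4_mod_U2_def)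
  have SG: "s \<in> SL2xSL2" if "s \<in> S" for s using that iwasawa_subset[OF iw1] by (auto simp: S_def)
  have \<phi>: "\<phi> s \<in> Sp4" if "s \<in> S" for s
    using that hom iwasawa_subset[OF iw2] by (auto simp: S_def lie_group_hom_def)
  have \<phi>_mult: "\<phi> (s ** t) = \<phi> s ** \<phi> t" if "s \<in> S" "t \<in> S" for s t
    using that hom by (auto simp: S_def lie_group_hom_def)
  have S_mult: "s ** t \<in> S" if "s \<in> S" "t \<in> S" for s t
    using that AN_mult[OF iw1] by (simp add: S_def)
  define X where "X s = SL2xSL2_act s o1" for s
  have XH: "X s \<in> H2 \<times> H2" if "s \<in> S" for s
    unfolding X_def by (rule SL2xSL2_act_in[OF SG[OF that] o1(1)])
  \<comment> \<open>A representative of the coset \<open>g (X s)\<close>, on which \<open>s\<close>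
    acts by left translation with \<open>\<phi> s\<close>.\<close>
  define \<gamma> where "\<gamma> s = \<phi> s ** h" for s
  have \<gamma>: "\<gamma> s \<in> Sp4" if "s \<in> S" for s using that \<phi> h by (simp add: \<gamma>_def Sp4_mult)
  define b where "b = 2 * exp B"
  have b: "b > 0" by (simp add: b_def)
  have F\<gamma>: "norm (matrix_inv (stretch_lift (X s)) ** \<gamma> s) \<le> b" if "s \<in> S" for s
  proof -
    have "g (X s) = left_coset (\<gamma> s)"
      using g that by (simp add: X_def S_def \<gamma>_def h(2) Sp4_act_left_coset)
    then show ?thesis
      unfolding b_def using B[OF XH[OF that]] by (intro norm_le_of_dist[OF iw2 stretch_lift_Sp4[OF XH[OF that]] \<gamma>[OF that]]) simp
  qed
  have \<gamma>F: "norm (matrix_inv (\<gamma> s) ** stretch_lift (X s)) \<le> b" if "s \<in> S" for s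
    using F\<gamma>[OF that] norm_matrix_inv_mult_commute[OF stretch_lift_Sp4[OF XH[OF that]] \<gamma>[OF that]] by simp
  \<comment> \<open>Exchanging lifts of \<open>f\<close> for \<open>\<gamma>\<close> costs a factor
    \<open>b\<close> at each endpoint; the converse exchange below costs the same.\<close>
  have FF: "norm (matrix_inv (stretch_lift (X s)) ** stretch_lift (X t)) \<le> b * (norm (matrix_inv (\<gamma> s) ** \<gamma> t) * b)"
    if st: "s \<in> S" "t \<in> S" for s t
  proof -
    have "norm (matrix_inv (stretch_lift (X s)) ** stretch_lift (X t)) \<le>
        norm (matrix_inv (stretch_lift (X s)) ** \<gamma> s) * norm (matrix_inv (\<gamma> s) ** stretch_lift (X t))"
      by (intro norm_matrix_inv_mult_triangle stretch_lift_Sp4 XH \<gamma> st)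
    also have "\<dots> \<le> norm (matrix_inv (stretch_lift (X s)) ** \<gamma> s) *
        (norm (matrix_inv (\<gamma> s) ** \<gamma> t) * norm (matrix_inv (\<gamma> t) ** stretch_lift (X t)))"
      by (intro mult_left_mono norm_matrix_inv_mult_triangle stretch_lift_Sp4 XH \<gamma> st) simp
    also have "\<dots> \<le> b * (norm (matrix_inv (\<gamma> s) ** \<gamma> t) * b)"
      using b by (intro mult_mono F\<gamma> \<gamma>F st mult_nonneg_nonneg) auto
    finally show ?thesis .
  qed
  have \<gamma>\<gamma>: "norm (matrix_inv (\<gamma> s) ** \<gamma> t) \<le> b * (norm (matrix_inv (stretch_lift (X s)) ** stretch_lift (X t)) * b)"
    if st: "s \<in> S" "t \<in> S" for s t
  proof -
    have "norm (matrix_inv (\<gamma> s) ** \<gamma> t) \<le>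
        norm (matrix_inv (\<gamma> s) ** stretch_lift (X s)) * norm (matrix_inv (stretch_lift (X s)) ** \<gamma> t)"
      by (intro norm_matrix_inv_mult_triangle stretch_lift_Sp4 XH \<gamma> st)
    also have "\<dots> \<le> norm (matrix_inv (\<gamma> s) ** stretch_lift (X s)) *
        (norm (matrix_inv (stretch_lift (X s)) ** stretch_lift (X t)) * norm (matrix_inv (stretch_lift (X t)) ** \<gamma> t))"
      by (intro mult_left_mono norm_matrix_inv_mult_triangle stretch_lift_Sp4 XH \<gamma> st) simp
    also have "\<dots> \<le> b * (norm (matrix_inv (stretch_lift (X s)) ** stretch_lift (X t)) * b)"
      using b by (intro mult_mono F\<gamma> \<gamma>F st mult_nonneg_nonneg) auto
    finally show ?thesis .
  qed
  \<comment> \<open>Chosen to contradict \<open>R \<le> 12 * b^8\<close>, the outcome of the final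
    comparison.\<close>
  define R where "R = 12 * b^8 + 1"
  have R: "R \<ge> 1" using b by (simp add: R_def)
  \<comment> \<open>Puts \<open>z\<close> close enough to the boundary point 1 for
    \<open>Q_stretch_deep\<close> with \<open>q = R + 1 / R\<close>, the value of \<open>Q\<close>
    at \<open>\<i>\<close> and \<open>of_real R * \<i>\<close>.\<close>
  define e where "e = 1 / (16 * (R + 1 / R))"
  have e: "e > 0" "16 * (R + 1 / R) * e \<le> 1" using R by (auto simp: e_def intro!: add_pos_pos)
  define z where "z = 1 + of_real e * \<i>"
  have pts: "(\<i>, \<i>) \<in> H2 \<times> H2" "(of_real R * \<i>, \<i>) \<in> H2 \<times> H2" "(z, \<i>) \<in> H2 \<times> H2"
    using R e by (auto simp: H2_def z_def)
  obtain s0 where s0: "s0 \<in> S" "X s0 = (\<i>, \<i>)"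
    using AN_transitive[OF iw1 o1 pts(1)] unfolding S_def X_def by blast
  obtain t0 where t0: "t0 \<in> S" "X t0 = (of_real R * \<i>, \<i>)"
    using AN_transitive[OF iw1 o1 pts(2)] unfolding S_def X_def by blast
  obtain s1 where s1: "s1 \<in> S" "X s1 = (z, \<i>)"
    using AN_transitive[OF iw1 o1 pts(3)] unfolding S_def X_def by blast
  obtain s0' where s0': "s0' \<in> S" "s0 ** s0' = mat 1" "s0' ** s0 = mat 1"
    using AN_inverse[OF iw1] s0(1) unfolding S_def by blast
  \<comment> \<open>Right multiplication by \<open>a\<close> leads from \<open>s0\<close> to
    \<open>t0\<close>; the same \<open>a\<close> is then applied at \<open>s1\<close>.\<close>
  define a where "a = s0' ** t0"
  have a: "a \<in> S" using s0' t0 by (simp add: a_def S_mult)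
  have t0a: "t0 = s0 ** a" by (simp add: a_def matrix_mul_assoc s0')
  have s1a: "s1 ** a \<in> S" using s1 a by (simp add: S_mult)
  \<comment> \<open>Left multiplication by \<open>M\<close> takes the pair \<open>s0\<close>,
    \<open>t0\<close> to the pair \<open>s1\<close>, \<open>s1 ** a\<close> and acts isometrically,
    so the values of \<open>Q\<close> carry over.\<close>
  define M where "M = s1 ** s0'"
  have M: "M \<in> SL2xSL2" by (simp add: M_def SL2xSL2_mult SG s1 s0')
  have "s1 = M ** s0" "s1 ** a = M ** t0"
    by (simp_all add: M_def a_def matrix_mul_assoc[symmetric] s0')
  then have XM: "X s1 = SL2xSL2_act M (X s0)" "X (s1 ** a) = SL2xSL2_act M (X t0)"
    unfolding X_def by (simp_all add: SL2xSL2_act_mult M SG s0 t0 o1)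
  have QR: "Q \<i> (of_real R * \<i>) = R + 1 / R"
    using R by (simp add: Q_def field_simps power2_eq_square)
  have Q1: "Q z (fst (X (s1 ** a))) = R + 1 / R"
    using SL2xSL2_act_Q(1)[OF M XH[OF s0(1)] XH[OF t0(1)], folded XM] by (simp add: s0 s1 t0 QR)
  have Q2: "Q \<i> (snd (X (s1 ** a))) = 2"
    using SL2xSL2_act_Q(2)[OF M XH[OF s0(1)] XH[OF t0(1)], folded XM] Q_self[of \<i>]
    by (simp add: s0 s1 t0 H2_def)
  \<comment> \<open>The factor \<open>\<phi> s\<close> cancels, so \<open>g\<close> displaces
    equally at \<open>s0\<close> and at \<open>s1\<close>.\<close>
  have same: "matrix_inv (\<gamma> s) ** \<gamma> (s ** a) = matrix_inv h ** \<phi> a ** h" if "s \<in> S" for s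
  proof -
    have "matrix_inv (\<gamma> s) ** \<gamma> (s ** a) = matrix_inv h ** (matrix_inv (\<phi> s) ** \<phi> s) ** \<phi> a ** h"
      using that a h \<phi> by (simp add: \<gamma>_def matrix_inv_mult_Sp4 \<phi>_mult matrix_mul_assoc)
    then show ?thesis using \<phi>[OF that] by (simp add: Sp4_inverse)
  qed
  let ?n0 = "norm (matrix_inv (stretch_lift (X s0)) ** stretch_lift (X t0))"
  let ?n1 = "norm (matrix_inv (stretch_lift (X s1)) ** stretch_lift (X (s1 ** a)))"
  \<comment> \<open>Two exchanges between \<open>f\<close> and \<open>g\<close> bound the
    displacement of \<open>f\<close> on the axis by \<open>b^4\<close> times its displacement near
    the boundary point 1.\<close>
  have "?n0 \<le> b * (norm (matrix_inv (\<gamma> s1) ** \<gamma> (s1 ** a)) * b)"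
    using FF[OF s0(1) t0(1)] same[OF s0(1)] same[OF s1(1)] by (simp add: t0a)
  also have "\<dots> \<le> b * ((b * (?n1 * b)) * b)"
    using b \<gamma>\<gamma>[OF s1(1) s1a] by (intro mult_left_mono mult_right_mono) auto
  also have "\<dots> = b^4 * ?n1" by (simp add: power4_eq_xxxx)
  finally have "?n0\<^sup>2 \<le> (b^4 * ?n1)\<^sup>2" by (intro power_mono) auto
  then have n: "?n0\<^sup>2 \<le> b^8 * ?n1\<^sup>2" by (simp add: power_mult_distrib flip: power_mult)
  \<comment> \<open>Stretching squares the coordinate on the axis, so \<open>?n0\<^sup>2\<close> has
    order \<open>R\<^sup>2\<close>, whereas \<open>?n1\<^sup>2\<close> is only of order
    \<open>R\<close>; the second factor adds 2 to each.\<close>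
  have "stretch \<i> = \<i>" "stretch (of_real R * \<i>) = of_real (R\<^sup>2) * \<i>"
    using R by (simp_all add: stretch_def norm_mult power2_eq_square)
  then have "?n0\<^sup>2 = R\<^sup>2 + 1 / R\<^sup>2 + 2"
    using norm_stretch_lift[OF XH[OF s0(1)] XH[OF t0(1)]] s0 t0 R Q_self[of \<i>]
    by (simp add: H2_def) (simp add: Q_def field_simps power2_eq_square)
  then have "R\<^sup>2 \<le> ?n0\<^sup>2" using R by simp
  also note n
  also have "?n1\<^sup>2 \<le> 5 * (R + 1 / R) + 2"
  proof -
    have "fst (X (s1 ** a)) \<in> H2" using XH[OF s1a] by auto
    from Q_stretch_deep[OF e(1,2) this] Q1 have "Q (stretch z) (stretch (fst (X (s1 ** a)))) \<le> 5 * (R + 1 / R)"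
      by (simp add: z_def)
    then show ?thesis
      using norm_stretch_lift[OF XH[OF s1(1)] XH[OF s1a]] s1 Q2 by simp
  qed
  also have "5 * (R + 1 / R) + 2 \<le> 12 * R"
  proof -
    have "1 / R \<le> 1" using R by simp
    then show ?thesis using R by argo
  qed
  finally have "R\<^sup>2 \<le> b^8 * (12 * R)" using b by (simp add: mult_left_mono)
  then have "R * R \<le> (12 * b^8) * R" by (simp add: power2_eq_square mult_ac)
  then have "R \<le> 12 * b^8" using R by simp
  then show False by (simp add: R_def)
qed

theorem theorem1p7:
  shows "\<exists>f :: complex \<times> complex \<Rightarrow> mat4 set.
    quasi_isometric_embedding (H2 \<times> H2) H2xH2_dist Sp4_mod_U2 Sp4_mod_U2_dist f \<and>
    (\<forall>g. AN_map SL2xSL2 (H2 \<times> H2) SL2xSL2_act Sp4 Sp4_mod_U2 Sp4_act g \<longrightarrow>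
         \<not> at_bounded_distance (H2 \<times> H2) Sp4_mod_U2_dist f g)"
  using quasi_isometric_embedding_stretch_lift AN_map_unbounded by blast

end
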